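(* Let $N$ be an integer and $N>p\ge 2$, $0\le b<\frac{N-p}{p}$ and $a=\frac{Nb}{N-p}$. There is a universal constant $C(N,p,b)>0$ (depending only on $N,p,b$) such that for all $u\in\mathcal{C}_0^\infty(\mathbb{R}^N\setminus\{\mathbf{0}\})\setminus\{0\}$, $$\left(\int_{\mathbb{R}^N}\frac{|\nabla u|^p}{|x|^{pb}}\,\mathrm{d}x\right)^{\frac1p}\left(\int_{\mathbb{R}^N}\frac{|u|^p}{|x|^{pa}}\,\mathrm{d}x\right)^{\frac{p-1}{p}}-\frac{N-(p-1)a-b-1}{p}\int_{\mathbb{R}^N}\frac{|u|^p}{|x|^{(p-1)a+b+1}}\,\mathrm{d}x$$ $$\ge C(N,p,b)\left(\frac{\int_{\mathbb{R}^N}\frac{|\nabla u|^p}{|x|^{pb}}\,\mathrm{d}x}{\int_{\mathbb{R}^N}\frac{|u|^p}{|x|^{pa}}\,\mathrm{d}x}\right)^{\frac1p}\inf_{c\in\mathbb{R},\,\lambda>0}\int_{\mathbb{R}^N}\frac{\left|u-c\,e^{-\frac{|x|^{b-a+1}}{(b-a+1)\lambda^{b-a+1}}}\right|^p}{|x|^{pa}}\,\mathrm{d}x,$$ which is equivalent to $$1-\frac{\frac{N-(p-1)a-b-1}{p}\int_{\mathbb{R}^N}\frac{|u|^p}{|x|^{(p-1)a+b+1}}\,\mathrm{d}x}{\left(\int_{\mathbb{R}^N}\frac{|\nabla u|^p}{|x|^{pb}}\,\mathrm{d}x\right)^{\frac1p}\left(\int_{\mathbb{R}^N}\frac{|u|^p}{|x|^{pa}}\,\mathrm{d}x\right)^{\frac{p-1}{p}}}\ge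 C(N,p,b)\inf_{v\in\mathcal{M}_{a,b}}\left(\frac{\int_{\mathbb{R}^N}\frac{|u-v|^p}{|x|^{pa}}\,\mathrm{d}x}{\int_{\mathbb{R}^N}\frac{|u|^p}{|x|^{pa}}\,\mathrm{d}x}\right).$$
   Context: $\mathcal{C}_0^\infty(\mathbb{R}^N\setminus\{\mathbf{0}\})$ is the set of real-valued smooth functions compactly supported in $\mathbb{R}^N\setminus\{\mathbf{0}\}$. The set $\mathcal{M}_{a,b}$ is $$\mathcal{M}_{a,b}:=\left\{\alpha e^{\frac{\beta}{b-a+1}|x|^{b-a+1}}:\ \alpha\in\mathbb{R},\ \frac{\beta}{b-a+1}<0\right\},$$ where $\beta\in\mathbb{R}$. *)

theory Defs
  imports "HOL-Analysis.Analysis"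
begin

fun k_smooth :: "nat \<Rightarrow> ('a::euclidean_space \<Rightarrow> real) \<Rightarrow> bool" where
  "k_smooth 0 f \<longleftrightarrow> continuous_on UNIV f"
| "k_smooth (Suc k) f \<longleftrightarrow>
     (\<forall>x. f differentiable (at x)) \<and> (\<forall>v. k_smooth k (\<lambda>x. frechet_derivative f (at x) v))"

(* Functions on the punctured space are represented by their extension by zero;
   compact support in the punctured space means that the closure of the
   nonvanishing set, taken in the whole space, is compact and avoids the origin. *)
definition Cc_smooth_punctured :: "('a::euclidean_space \<Rightarrow> real) set" where
  "Cc_smooth_punctured =
     {u. (\<forall>k. k_smooth k u) \<and> compact (closure {x. u x \<noteq> 0}) \<and> 0 \<notin> closure {x. u x \<noteq> 0}}"

definition gradient :: "(real ^ 'n \<Rightarrow> real) \<Rightarrow> real ^ 'n \<Rightarrow> real ^ 'n" where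
  "gradient u x = (\<chi> i. frechet_derivative u (at x) (axis i 1))"

(* In the two integrals below, powr and division take the value 0 at the origin
   (0 powr s = 0 and t / 0 = 0); this affects only a null set. *)
definition weighted_integral :: "real \<Rightarrow> real \<Rightarrow> (real ^ 'n \<Rightarrow> real) \<Rightarrow> real" where
  "weighted_integral p s f = (LINT x|lborel. \<bar>f x\<bar> powr p / norm x powr s)"

definition weighted_gradient_integral :: "real \<Rightarrow> real \<Rightarrow> (real ^ 'n \<Rightarrow> real) \<Rightarrow> real" where
  "weighted_gradient_integral p s u = (LINT x|lborel. norm (gradient u x) powr p / norm x powr s)"

definition M_set :: "real \<Rightarrow> real \<Rightarrow> (real ^ 'n \<Rightarrow> real) set" where
  "M_set a b =
     {\<lambda>x. \<alpha> * exp (\<beta> / (b - a + 1) * norm x powr (b - a + 1)) | \<alpha> \<beta>. \<beta> / (b - a + 1) < 0}"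

definition stability_ineq :: "real \<Rightarrow> real \<Rightarrow> real \<Rightarrow> real \<Rightarrow> (real ^ 'n \<Rightarrow> real) \<Rightarrow> bool" where
  "stability_ineq p a b C u \<longleftrightarrow>
     weighted_gradient_integral p (p * b) u powr (1 / p)
         * weighted_integral p (p * a) u powr ((p - 1) / p)
       - (real CARD('n) - (p - 1) * a - b - 1) / p * weighted_integral p ((p - 1) * a + b + 1) u
     \<ge> C * (weighted_gradient_integral p (p * b) u / weighted_integral p (p * a) u) powr (1 / p)
         * (INF (c, l) \<in> UNIV \<times> {0<..}. weighted_integral p (p * a)
             (\<lambda>x. u x - c * exp (- (norm x powr (b - a + 1) / ((b - a + 1) * l powr (b - a + 1))))))"

definition normalized_stability_ineq :: "real \<Rightarrow> real \<Rightarrow> real \<Rightarrow> real \<Rightarrow> (real ^ 'n \<Rightarrow> real) \<Rightarrow> bool" where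
  "normalized_stability_ineq p a b C u \<longleftrightarrow>
     1 - ((real CARD('n) - (p - 1) * a - b - 1) / p * weighted_integral p ((p - 1) * a + b + 1) u)
         / (weighted_gradient_integral p (p * b) u powr (1 / p)
            * weighted_integral p (p * a) u powr ((p - 1) / p))
     \<ge> C * (INF v \<in> M_set a b.
               weighted_integral p (p * a) (\<lambda>x. u x - v x) / weighted_integral p (p * a) u)"

end

theory Submission
  imports Defs
begin

text \<open>Put \<open>\<gamma> = b - a + 1 > 0\<close> and \<open>A = \<integral> |\<nabla>u|\<^sup>p |x|\<^bsup>-pb\<^esup>\<close>, \<open>B = \<integral> |u|\<^sup>p |x|\<^bsup>-pa\<^esup>\<close>. The uniform convexity
  of \<open>|\<cdot>|\<^sup>p\<close> for \<open>p \<ge> 2\<close>, applied to \<open>\<nabla>u\<close> and \<open>-\<mu> u |x|\<^bsup>\<gamma>-2\<^esup> x\<close> with \<open>\<mu> = (A/B)\<^bsup>1/p\<^esup>\<close>, bounds \<open>p \<mu>\<^bsup>p-1\<^esup>\<close> times the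
  left-hand side from below by a multiple of \<open>\<integral> |\<nabla>(u/v)|\<^sup>p v\<^sup>p |x|\<^bsup>-pb\<^esup>\<close>, where \<open>v = exp (-\<mu> |x|\<^sup>\<gamma> / \<gamma>)\<close>. What
  remains is the weighted Poincare inequality
  \<open>\<integral> |f - c|\<^sup>p v\<^sup>p |x|\<^bsup>-pa\<^esup> \<le> C \<mu>\<^bsup>-p\<^esup> \<integral> |\<nabla>f|\<^sup>p v\<^sup>p |x|\<^bsup>-pb\<^esup>\<close>; by scaling one may take \<open>\<mu> = 1\<close>. Comparing \<open>|f - c|\<^sup>p\<close> with
  its dilation by 2 near the origin (where \<open>pa < N\<close> makes the weight contract) and by 1/2 near infinity
  (where the exponential does) reduces it to the Poincare inequality on a ball, which carries over
  because \<open>|x|\<^bsup>-pb\<^esup>\<close> is bounded below there.\<close>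

subsection \<open>Powers and norms\<close>

text \<open>The choice of \<mu> is the equality case of Young's inequality: A + (p - 1) \<mu>^p B =
  p \<mu>^(p-1) A^(1/p) B^((p-1)/p), so the sum that convexity produces becomes the product in the
  claim. The cross term of the convexity inequality is a radial derivative of |u|^p against
  |x|^(-s), s = (p-1)a + b + 1; its integral is the subtracted integral with coefficient N - s. The
  Poincare constant must not depend on u; since u enters the weights through \<mu> alone, scaling
  suffices. The obstacle is that |x|^(-pa) may be unbounded at the origin and that a ball misses
  infinity. Each dilation comparison returns a fraction of the left side plus the integral of
  |x|^(1-\<gamma>) |\<nabla>\<Phi>| against the weight, where \<Phi> = |f - c|^p. As
  |\<nabla>\<Phi>| <= p |f - c|^(p-1) |\<nabla>f| and pa = pb + p(1-\<gamma>), Young's inequality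
  splits this into a small multiple of the left side and exactly the gradient integral wanted. All
  absorptions presuppose a finite left side, so finiteness is carried along as a premise until the
  end.\<close>

lemma powr_above_tangent:
  fixes x y q :: real
  assumes "x \<ge> 0" "y \<ge> 0" "q \<ge> 1"
  shows "x powr q + q * x powr (q - 1) * (y - x) \<le> y powr q"
proof (cases "x = 0")
  case False
  then have x: "x > 0" using assms by simp
  have d: "((\<lambda>z. z powr q) has_real_derivative q * x powr (q - 1)) (at x)"
    using x by (auto intro!: derivative_eq_intros)
  have pos: "x powr q + q * x powr (q - 1) * (w - x) \<le> w powr q" if "w > 0" for w
  proof -
    have "w powr q - x powr q \<ge> q * x powr (q - 1) * (w - x)"
      by (rule convex_on_imp_above_tangent[of "{0<..}"])
         (use x that assms d in \<open>auto intro: powr_convex has_field_derivative_at_within simp: interior_open\<close>)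
    then show ?thesis by simp
  qed
  show ?thesis
  proof (cases "y = 0")
    case True
    have "x powr q = x powr (q - 1) * x" using x by (simp add: powr_diff)
    then have "x powr q + q * x powr (q - 1) * (y - x) = (1 - q) * (x powr (q-1) * x)"
      using True by (simp add: algebra_simps)
    also have "\<dots> \<le> 0" using assms x by (simp add: mult_nonpos_nonneg)
    finally show ?thesis using True by simp
  qed (use pos assms in auto)
qed (use assms in auto)

text \<open>A dichotomy replaces conjugate exponents: either B is at most \<epsilon> A or A is at
  most B / \<epsilon>, and substituting into the product gives one of the two terms. Sharp constants
  do not matter; what counts is that the factor of \<open>A powr p\<close> can be made small enough
  to be absorbed.\<close>

lemma powr_Young:
  fixes A B \<epsilon> p :: real
  assumes "A \<ge> 0" "B \<ge> 0" "\<epsilon> > 0" "p > 1"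
  shows "A powr (p - 1) * B \<le> \<epsilon> * A powr p + \<epsilon> powr (1 - p) * B powr p"
proof (cases "B \<le> \<epsilon> * A")
  case True
  have "A powr (p - 1) * B \<le> A powr (p - 1) * (\<epsilon> * A)"
    using True by (intro mult_left_mono) auto
  also have "\<dots> = \<epsilon> * A powr p" using assms by (cases "A = 0") (auto simp: powr_diff)
  finally show ?thesis by (smt (verit) mult_nonneg_nonneg powr_ge_zero)
next
  case False
  then have B: "B > 0" using assms by (smt (verit) mult_nonneg_nonneg)
  have "A \<le> B / \<epsilon>" using False assms by (simp add: field_simps)
  then have "A powr (p - 1) * B \<le> (B / \<epsilon>) powr (p - 1) * B"
    using assms by (intro mult_right_mono powr_mono2) auto
  also have "\<dots> = \<epsilon> powr (1 - p) * B powr p"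
    using assms B by (simp add: powr_divide powr_diff powr_minus field_simps)
  finally show ?thesis using assms by (smt (verit) mult_nonneg_nonneg powr_ge_zero)
qed

text \<open>For small increments the second-order term of the expansion of the square of the norm
  dominates; for large ones the increment dominates everything else.\<close>

lemma norm_powr_strictly_convex:
  fixes x d :: "'a::real_inner" and p :: real
  assumes p: "p \<ge> 2"
  defines "\<kappa> \<equiv> min (1/2) (p / 2 * (4 * p + 2) powr (2 - p))"
  shows "norm x powr p + p * norm x powr (p - 2) * (x \<bullet> d) + \<kappa> * norm d powr p \<le> norm (x + d) powr p"
proof -
  \<comment> \<open>Chosen so that (1 + 2p) / K = 1/2, which balances the case of large increments
    exactly: (1 + p) / K + 1/2 = 1 - p / K.\<close>
  define K where "K = 4 * p + 2"
  have K: "K > 0" "K \<ge> 10" using p by (auto simp: K_def)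
  have \<kappa>: "\<kappa> \<le> 1/2" "\<kappa> \<le> p / 2 * K powr (2 - p)" "\<kappa> > 0" using K p by (auto simp: \<kappa>_def K_def)
  show ?thesis
  proof (cases "norm d \<le> K * norm x")
    case True
    \<comment> \<open>The p-th power of the norm is the convex power p / 2 of the squared norm. The
      tangent inequality at the square of |x| keeps the whole increment 2 (x . d) + |d|^2, and its
      quadratic part is the gain.\<close>
    have pp: "norm z powr p = (norm z ^ 2) powr (p / 2)" for z :: 'a
      by (cases "z = 0") (auto simp: powr_powr simp flip: powr_numeral)
    have pp2: "norm z powr (p - 2) = (norm z ^ 2) powr (p / 2 - 1)" for z :: 'a
      by (cases "z = 0") (auto simp: powr_powr algebra_simps simp flip: powr_numeral)
    have sq: "norm (x + d) ^ 2 - norm x ^ 2 = 2 * (x \<bullet> d) + norm d ^ 2"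
      by (simp add: power2_norm_eq_inner inner_add inner_commute)
    have *: "norm x powr p + p / 2 * norm x powr (p - 2) * (2 * (x \<bullet> d) + norm d ^ 2) \<le> norm (x + d) powr p"
      unfolding pp pp2 sq[symmetric] by (rule powr_above_tangent) (use p in auto)
    \<comment> \<open>Since |d| <= K |x| and p >= 2, |x|^(p-2) is at least K^(2-p) |d|^(p-2). This
      is the origin of the second entry of \<kappa>.\<close>
    have "\<kappa> * norm d powr p \<le> p / 2 * norm x powr (p - 2) * norm d ^ 2"
    proof (cases "d = 0")
      case False
      have "(norm d / K) powr (p - 2) \<le> norm x powr (p - 2)"
        using True K p by (intro powr_mono2) (auto simp: field_simps)
      then have "norm d powr (p - 2) * K powr (2 - p) \<le> norm x powr (p - 2)"
        using K by (simp add: powr_divide powr_diff powr_minus field_simps)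
      then have "p / 2 * (norm d powr (p - 2) * K powr (2 - p)) * norm d ^ 2 \<le> p / 2 * norm x powr (p - 2) * norm d ^ 2"
        using p by (intro mult_right_mono mult_left_mono) auto
      moreover have "norm d powr (p - 2) * norm d ^ 2 = norm d powr p"
        using False by (simp add: powr_diff)
      moreover have "p / 2 * (norm d powr (p - 2) * K powr (2 - p)) * norm d ^ 2
          = p / 2 * K powr (2 - p) * (norm d powr (p - 2) * norm d ^ 2)"
        by simp
      ultimately have "(p / 2 * K powr (2 - p)) * norm d powr p \<le> p / 2 * norm x powr (p - 2) * norm d ^ 2"
        by metis
      moreover have "\<kappa> * norm d powr p \<le> (p / 2 * K powr (2 - p)) * norm d powr p"
        using \<kappa> by (intro mult_right_mono) auto
      ultimately show ?thesis by linarith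
    qed auto
    moreover have "p / 2 * norm x powr (p - 2) * (2 * (x \<bullet> d) + norm d ^ 2)
        = p * norm x powr (p - 2) * (x \<bullet> d) + p / 2 * norm x powr (p - 2) * norm d ^ 2"
      by (simp add: distrib_left)
    ultimately show ?thesis using * by linarith
  next
    case False
    define D where "D = norm d"
    have D: "D > 0" using False K unfolding D_def by (smt (verit) mult_nonneg_nonneg norm_ge_zero)
    have x: "norm x \<le> D / K" using False K by (simp add: D_def field_simps)
    have "norm (x + d) \<ge> D - norm x" unfolding D_def using norm_triangle_ineq2[of d "-x"] by (simp add: add.commute)
    then have y: "norm (x + d) \<ge> (1 - 1 / K) * D" using x by (simp add: algebra_simps)
    \<comment> \<open>Bernoulli's inequality, read off from the tangent at 1.\<close>
    have "1 - p / K \<le> (1 - 1 / K) powr p"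
      using powr_above_tangent[of 1 "1 - 1/K" p] K p by (simp add: field_simps)
    then have "(1 - p / K) * D powr p \<le> (1 - 1 / K) powr p * D powr p"
      by (intro mult_right_mono) auto
    also have "\<dots> = ((1 - 1 / K) * D) powr p" using D K by (simp add: powr_mult)
    also have "\<dots> \<le> norm (x + d) powr p" using y D K p by (intro powr_mono2) auto
    finally have 1: "(1 - p / K) * D powr p \<le> norm (x + d) powr p" .
    have Kle: "K powr (-r) \<le> 1 / K" if "r \<ge> 1" for r
      using powr_mono[of "-r" "-1" K] K that by (simp add: powr_minus inverse_eq_divide)
    have "norm x powr p \<le> (D / K) powr p" using x p by (intro powr_mono2) auto
    also have "\<dots> = D powr p * K powr (-p)" using D K by (simp add: powr_divide powr_minus field_simps)
    also have "\<dots> \<le> D powr p * (1 / K)" using Kle[of p] p by (intro mult_left_mono) auto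
    finally have 2: "norm x powr p \<le> D powr p * (1 / K)" .
    have "norm x powr (p - 2) * (x \<bullet> d) \<le> norm x powr (p - 2) * (norm x * D)"
      unfolding D_def by (intro mult_left_mono norm_cauchy_schwarz) auto
    also have "\<dots> = norm x powr (p - 1) * D"
      by (cases "x = 0") (auto simp: powr_diff power2_eq_square)
    also have "\<dots> \<le> (D / K) powr (p - 1) * D" using x p D by (intro mult_right_mono powr_mono2) auto
    also have "\<dots> = D powr p * K powr (-(p - 1))"
      using D K by (simp add: powr_divide powr_diff powr_minus field_simps)
    also have "\<dots> \<le> D powr p * (1 / K)" using Kle[of "p - 1"] p by (intro mult_left_mono) auto
    finally have "p * (norm x powr (p - 2) * (x \<bullet> d)) \<le> p * (D powr p * (1 / K))"
      using p by (intro mult_left_mono) auto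
    then have "norm x powr p + p * norm x powr (p - 2) * (x \<bullet> d) + \<kappa> * D powr p
        \<le> D powr p * (1 / K) + p * (D powr p * (1 / K)) + 1/2 * D powr p"
      using 2 \<kappa>(1) by (intro add_mono mult_right_mono) auto
    also have "\<dots> = ((1 + p) / K + 1/2) * D powr p"
      by (simp add: algebra_simps add_divide_distrib)
    also have "\<dots> = (1 - p / K) * D powr p" 
    proof -
      have "K = 2 * (1 + 2 * p)" by (simp add: K_def)
      then have "(1 + 2 * p) / K = 1 / 2" using p by simp
      then have "(1 + p) / K + 1/2 = 1 - p / K" by (simp add: add_divide_distrib)
      then show ?thesis by simp
    qed
    finally show ?thesis using 1 by (simp add: D_def)
  qed
qed

text \<open>Only 0 needs care: there the difference quotient has modulus |h|^(p-1), which tends to 0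
  because p > 1. Elsewhere the sign is locally constant.\<close>

lemma has_real_derivative_abs_powr:
  fixes r p :: real
  assumes "p > 1"
  shows "((\<lambda>s. \<bar>s\<bar> powr p) has_real_derivative p * \<bar>r\<bar> powr (p - 1) * sgn r) (at r)"
proof (cases "r = 0")
  case True
  have "((\<lambda>h. \<bar>h\<bar> powr (p - 1)) \<longlongrightarrow> 0) (at (0::real))"
    by (rule tendsto_eq_intros) (use assms in \<open>auto intro!: tendsto_eq_intros\<close>)
  then have "((\<lambda>h. \<bar>h\<bar> powr p / h) \<longlongrightarrow> 0) (at (0::real))"
    by (rule tendsto_0_le[where K=1])
       (auto simp: powr_diff abs_div_pos intro!: eventually_at_filter[THEN iffD2] always_eventually)
  then show ?thesis using True by (simp add: DERIV_def)
next
  case False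
  have "((\<lambda>s. \<bar>s\<bar>) has_real_derivative sgn r) (at r)"
  proof (rule has_field_derivative_transform_within_open[of "\<lambda>s. sgn r * s" _ _ "ball r \<bar>r\<bar>"])
    show "sgn r * s = \<bar>s\<bar>" if "s \<in> ball r \<bar>r\<bar>" for s
      using that by (auto simp: dist_real_def sgn_real_def abs_if split: if_splits)
  qed (use False in \<open>auto intro!: derivative_eq_intros\<close>)
  then show ?thesis using False assms
    by (auto intro!: derivative_eq_intros simp: mult_ac)
qed

text \<open>The sign jumps at 0, but the power damps the jump. Up to a factor this is the derivative
  of |s|^(e+1), and its continuity is what the fundamental theorem of calculus along rays
  requires.\<close>

lemma continuous_on_sgn_powr:
  fixes e :: real
  assumes e: "0 < e"
  shows "continuous_on UNIV (\<lambda>s::real. \<bar>s\<bar> powr e * sgn s)"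
proof (rule continuous_at_imp_continuous_on, rule ballI)
  fix s :: real
  show "isCont (\<lambda>s. \<bar>s\<bar> powr e * sgn s) s"
  proof (cases "s = 0")
    case True
    have "((\<lambda>h. \<bar>h\<bar> powr e) \<longlongrightarrow> 0) (at (0::real))"
      by (rule tendsto_eq_intros) (use e in \<open>auto intro!: tendsto_eq_intros\<close>)
    then have "((\<lambda>h. \<bar>h\<bar> powr e * sgn h) \<longlongrightarrow> 0) (at (0::real))"
      by (rule tendsto_0_le[where K=1])
         (auto simp: abs_mult abs_sgn_eq intro!: eventually_at_filter[THEN iffD2] always_eventually)
    then show ?thesis using True by (simp add: isCont_def)
  qed (auto intro!: continuous_intros)
qed

lemma has_real_derivative_along_line:
  fixes f :: "'a::real_inner \<Rightarrow> real"
  assumes "\<And>x. (f has_derivative (\<lambda>h. G x \<bullet> h)) (at x)"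
  shows "((\<lambda>t. f (x + t *\<^sub>R v)) has_real_derivative G (x + t *\<^sub>R v) \<bullet> v) (at t)"
proof -
  have "((\<lambda>t. x + t *\<^sub>R v) has_derivative (\<lambda>h. h *\<^sub>R v)) (at t)"
    by (auto intro!: derivative_eq_intros)
  from has_derivative_compose[OF this assms] show ?thesis
    by (simp add: has_field_derivative_def mult_commute_abs)
qed

subsection \<open>Integrals along rays and dilations\<close>

lemma nn_integral_lborel_affine:
  fixes f :: "'a::euclidean_space \<Rightarrow> ennreal"
  assumes [measurable]: "f \<in> borel_measurable borel" and c: "c > 0"
  shows "(\<integral>\<^sup>+x. f (a + c *\<^sub>R x) \<partial>lborel) = ennreal (inverse c ^ DIM('a)) * (\<integral>\<^sup>+x. f x \<partial>lborel)"
proof -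
  have "(\<integral>\<^sup>+x. f x \<partial>lborel) = ennreal (c ^ DIM('a)) * (\<integral>\<^sup>+x. f (a + c *\<^sub>R x) \<partial>lborel)"
    using c by (subst lborel_affine[of c a])
      (auto simp: nn_integral_density nn_integral_distr nn_integral_cmult)
  then show ?thesis using c
    by (simp add: mult.assoc[symmetric] ennreal_mult'[symmetric] power_mult_distrib[symmetric])
qed

lemma integral_lborel_scaleR:
  fixes f :: "'a::euclidean_space \<Rightarrow> real"
  assumes [measurable]: "f \<in> borel_measurable borel" and c: "c > 0"
  shows "(\<integral>x. f (c *\<^sub>R x) \<partial>lborel) = inverse c ^ DIM('a) * (\<integral>x. f x \<partial>lborel)"
proof -
  have "(\<integral>x. f x \<partial>lborel) = c ^ DIM('a) * (\<integral>x. f (c *\<^sub>R x) \<partial>lborel)"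
    using c by (subst lborel_affine[of c 0])
      (auto simp: integral_density integral_distr)
  then show ?thesis using c
    by (simp add: mult.assoc[symmetric] power_mult_distrib[symmetric])
qed

text \<open>Tonelli before and after the substitution z = t x at fixed t. The Jacobian contributes
  one inverse power of t per dimension and |x| = |z| / t one more, hence \<open>Suc DIM('a)\<close>.
  The effect is to move the dilations from \<Psi> onto the weight.\<close>

lemma nn_integral_dilation_kernel:
  fixes w \<Psi> :: "'a::euclidean_space \<Rightarrow> ennreal"
  assumes [measurable]: "w \<in> borel_measurable borel" "\<Psi> \<in> borel_measurable borel"
    and \<alpha>: "0 < \<alpha>"
  shows "(\<integral>\<^sup>+x. w x * (\<integral>\<^sup>+t. ennreal (norm x) * \<Psi> (t *\<^sub>R x) * indicator {\<alpha>..\<beta>} t \<partial>lborel) \<partial>lborel)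
    = (\<integral>\<^sup>+z. ennreal (norm z) * \<Psi> z *
        (\<integral>\<^sup>+t. ennreal (inverse t ^ Suc DIM('a)) * w (inverse t *\<^sub>R z) * indicator {\<alpha>..\<beta>} t \<partial>lborel) \<partial>lborel)"
    (is "?L = ?R")
proof -
  have "?L = (\<integral>\<^sup>+x. \<integral>\<^sup>+t. w x * (ennreal (norm x) * \<Psi> (t *\<^sub>R x) * indicator {\<alpha>..\<beta>} t) \<partial>lborel \<partial>lborel)"
    by (subst nn_integral_cmult) auto
  also have "\<dots> = (\<integral>\<^sup>+t. \<integral>\<^sup>+x. w x * (ennreal (norm x) * \<Psi> (t *\<^sub>R x) * indicator {\<alpha>..\<beta>} t) \<partial>lborel \<partial>lborel)"
    by (rule lborel_pair.Fubini') measurable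
  also have "\<dots> = (\<integral>\<^sup>+t. \<integral>\<^sup>+z. ennreal (norm z) * \<Psi> z *
      (ennreal (inverse t ^ Suc DIM('a)) * w (inverse t *\<^sub>R z) * indicator {\<alpha>..\<beta>} t) \<partial>lborel \<partial>lborel)"
  proof (rule nn_integral_cong)
    fix t :: real
    show "(\<integral>\<^sup>+x. w x * (ennreal (norm x) * \<Psi> (t *\<^sub>R x) * indicator {\<alpha>..\<beta>} t) \<partial>lborel)
       = (\<integral>\<^sup>+z. ennreal (norm z) * \<Psi> z *
      (ennreal (inverse t ^ Suc DIM('a)) * w (inverse t *\<^sub>R z) * indicator {\<alpha>..\<beta>} t) \<partial>lborel)"
    proof (cases "t \<in> {\<alpha>..\<beta>}")
      case True
      then have t: "t > 0" using \<alpha> by simp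
      let ?g = "\<lambda>z. w (inverse t *\<^sub>R z) * ennreal (norm (inverse t *\<^sub>R z)) * \<Psi> z"
      have "(\<integral>\<^sup>+x. w x * (ennreal (norm x) * \<Psi> (t *\<^sub>R x) * indicator {\<alpha>..\<beta>} t) \<partial>lborel)
          = (\<integral>\<^sup>+x. ?g (0 + t *\<^sub>R x) \<partial>lborel)"
        using t True by (intro nn_integral_cong) (simp add: mult_ac)
      also have "\<dots> = ennreal (inverse t ^ DIM('a)) * (\<integral>\<^sup>+x. ?g x \<partial>lborel)"
        using t by (intro nn_integral_lborel_affine) auto
      also have "\<dots> = (\<integral>\<^sup>+x. ennreal (inverse t ^ DIM('a)) * ?g x \<partial>lborel)"
        by (subst nn_integral_cmult) auto
      also have "\<dots> = (\<integral>\<^sup>+z. ennreal (norm z) * \<Psi> z *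
      (ennreal (inverse t ^ Suc DIM('a)) * w (inverse t *\<^sub>R z) * indicator {\<alpha>..\<beta>} t) \<partial>lborel)"
        using t True by (intro nn_integral_cong) (simp add: ennreal_mult mult_ac)
      finally show ?thesis .
    qed auto
  qed
  also have "\<dots> = (\<integral>\<^sup>+z. \<integral>\<^sup>+t. ennreal (norm z) * \<Psi> z *
      (ennreal (inverse t ^ Suc DIM('a)) * w (inverse t *\<^sub>R z) * indicator {\<alpha>..\<beta>} t) \<partial>lborel \<partial>lborel)"
    by (rule lborel_pair.Fubini') measurable
  also have "\<dots> = ?R"
    by (subst nn_integral_cmult) auto
  finally show ?thesis .
qed

lemma abs_diff_le_nn_integral_deriv:
  fixes \<psi> \<psi>' :: "real \<Rightarrow> real"
  assumes "\<alpha> \<le> \<beta>"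
    and "\<And>t. t \<in> {\<alpha>..\<beta>} \<Longrightarrow> (\<psi> has_real_derivative \<psi>' t) (at t)"
    and "\<And>t. t \<in> {\<alpha>..\<beta>} \<Longrightarrow> \<bar>\<psi>' t\<bar> \<le> h t"
    and "continuous_on {\<alpha>..\<beta>} \<psi>'"
  shows "ennreal \<bar>\<psi> \<beta> - \<psi> \<alpha>\<bar> \<le> (\<integral>\<^sup>+t. ennreal (h t) * indicator {\<alpha>..\<beta>} t \<partial>lborel)"
proof -
  have "has_bochner_integral lborel (\<lambda>x. indicator {\<alpha>..\<beta>} x *\<^sub>R \<psi>' x) (\<psi> \<beta> - \<psi> \<alpha>)"
    using assms by (intro has_bochner_integral_FTC_Icc)
      (auto simp: has_real_derivative_iff_has_vector_derivative intro: has_vector_derivative_at_within)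
  then have int: "integrable lborel (\<lambda>x. indicator {\<alpha>..\<beta>} x *\<^sub>R \<psi>' x)"
    and eq: "(\<integral>x. indicator {\<alpha>..\<beta>} x *\<^sub>R \<psi>' x \<partial>lborel) = \<psi> \<beta> - \<psi> \<alpha>"
    by (auto simp: has_bochner_integral_iff)
  have "ennreal \<bar>\<psi> \<beta> - \<psi> \<alpha>\<bar> \<le> (\<integral>\<^sup>+x. ennreal (norm (indicator {\<alpha>..\<beta>} x *\<^sub>R \<psi>' x)) \<partial>lborel)"
    using integral_norm_bound_ennreal[OF int] unfolding eq by simp
  also have "\<dots> \<le> (\<integral>\<^sup>+t. ennreal (h t) * indicator {\<alpha>..\<beta>} t \<partial>lborel)"
    using assms(3) by (intro nn_integral_mono) (auto split: split_indicator intro!: ennreal_leI)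
  finally show ?thesis .
qed

text \<open>Jensen's inequality on the unit interval, obtained from the tangent line of the p-th
  power at the mean \<open>m\<close> of |\<psi>'|.\<close>

lemma abs_diff_powr_le_nn_integral_deriv:
  fixes \<psi> \<psi>' :: "real \<Rightarrow> real"
  assumes p: "1 \<le> p"
    and der: "\<And>t. t \<in> {0..1} \<Longrightarrow> (\<psi> has_real_derivative \<psi>' t) (at t)"
    and le: "\<And>t. t \<in> {0..1} \<Longrightarrow> \<bar>\<psi>' t\<bar> powr p \<le> h t"
    and cont: "continuous_on {0..1} \<psi>'"
  shows "ennreal (\<bar>\<psi> 1 - \<psi> 0\<bar> powr p) \<le> (\<integral>\<^sup>+t. ennreal (h t) * indicator {0..1} t \<partial>lborel)"
proof -
  define m where "m = (\<integral>t. indicator {0..1} t *\<^sub>R \<bar>\<psi>' t\<bar> \<partial>lborel)"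
  have int1: "integrable lborel (\<lambda>t::real. indicator {0..1} t *\<^sub>R \<bar>\<psi>' t\<bar>)"
    by (intro borel_integrable_compact continuous_intros cont) auto
  have int2: "integrable lborel (\<lambda>t::real. indicator {0..1} t *\<^sub>R (\<bar>\<psi>' t\<bar> powr p))"
    using p by (intro borel_integrable_compact continuous_intros cont continuous_on_powr') auto
  have int3: "integrable lborel (\<lambda>t::real. indicator {0..1} t *\<^sub>R (c::real))" for c
    by (intro borel_integrable_compact continuous_intros) auto
  have m0: "m \<ge> 0" unfolding m_def by (intro integral_nonneg_AE) auto
  have "ennreal \<bar>\<psi> 1 - \<psi> 0\<bar> \<le> (\<integral>\<^sup>+t. ennreal \<bar>\<psi>' t\<bar> * indicator {0..1} t \<partial>lborel)"
    using der cont by (intro abs_diff_le_nn_integral_deriv) auto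
  also have "\<dots> = (\<integral>\<^sup>+t. ennreal (indicator {0..1} t *\<^sub>R \<bar>\<psi>' t\<bar>) \<partial>lborel)"
    by (intro nn_integral_cong) (auto split: split_indicator)
  also have "\<dots> = ennreal m" unfolding m_def using int1 by (intro nn_integral_eq_integral) auto
  finally have "\<bar>\<psi> 1 - \<psi> 0\<bar> \<le> m" using m0 by simp
  then have "\<bar>\<psi> 1 - \<psi> 0\<bar> powr p \<le> m powr p" using p by (intro powr_mono2) auto
  also have "m powr p \<le> (\<integral>t. indicator {0..1} t *\<^sub>R (\<bar>\<psi>' t\<bar> powr p) \<partial>lborel)"
  proof -
    \<comment> \<open>The tangent at \<open>m\<close> is affine in |\<psi>'|, and the interval has
      length 1, so its integral is exactly \<open>m powr p\<close>.\<close>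
    have "m powr p = (\<integral>t. indicator {0..1} t *\<^sub>R (m powr p - p * m powr (p - 1) * m)
         + p * m powr (p - 1) * (indicator {0..1} t *\<^sub>R \<bar>\<psi>' t\<bar>) \<partial>lborel)"
      using int1 int3 by (subst Bochner_Integration.integral_add) (auto simp: m_def[unfolded real_scaleR_def, symmetric])
    also have "\<dots> \<le> (\<integral>t. indicator {0..1} t *\<^sub>R (\<bar>\<psi>' t\<bar> powr p) \<partial>lborel)"
    proof (rule integral_mono)
      fix t :: real
      show "indicator {0..1} t *\<^sub>R (m powr p - p * m powr (p - 1) * m)
         + p * m powr (p - 1) * (indicator {0..1} t *\<^sub>R \<bar>\<psi>' t\<bar>) \<le> indicator {0..1} t *\<^sub>R (\<bar>\<psi>' t\<bar> powr p)"
        using powr_above_tangent[OF m0, of "\<bar>\<psi>' t\<bar>" p] p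
        by (auto split: split_indicator simp: algebra_simps)
    qed (use int1 int2 int3 in auto)
    finally show ?thesis .
  qed
  finally have "ennreal (\<bar>\<psi> 1 - \<psi> 0\<bar> powr p) \<le> ennreal (\<integral>t. indicator {0..1} t *\<^sub>R (\<bar>\<psi>' t\<bar> powr p) \<partial>lborel)"
    by (rule ennreal_leI)
  also have "\<dots> = (\<integral>\<^sup>+t. ennreal (indicator {0..1} t *\<^sub>R (\<bar>\<psi>' t\<bar> powr p)) \<partial>lborel)"
    using int2 by (intro nn_integral_eq_integral[symmetric]) auto
  also have "\<dots> \<le> (\<integral>\<^sup>+t. ennreal (h t) * indicator {0..1} t \<partial>lborel)"
    using le by (intro nn_integral_mono) (auto split: split_indicator intro!: ennreal_leI)
  finally show ?thesis .
qed

subsection \<open>Poincare inequality on a ball\<close>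

text \<open>Averaging: the integral of \<open>F y\<close> over the ball is at most the claimed bound
  times the measure of the ball, so some value c = f y works. The factor (2R)^p bounds the length of
  a segment in the ball, raised to p; the power of 2 is the cost of a change of variables at a fixed
  position on the segments.\<close>

lemma Poincare_cball:
  fixes f :: "'a::euclidean_space \<Rightarrow> real" and G :: "'a \<Rightarrow> 'a"
  assumes p: "1 \<le> p" and R: "0 < R"
    and der: "\<And>x. (f has_derivative (\<lambda>h. G x \<bullet> h)) (at x)" and cont: "continuous_on UNIV G"
  obtains c where "(\<integral>\<^sup>+x. ennreal (\<bar>f x - c\<bar> powr p) * indicator (cball 0 R) x \<partial>lborel)
    \<le> ennreal (2 ^ DIM('a) * (2 * R) powr p) * (\<integral>\<^sup>+x. ennreal (norm (G x) powr p) * indicator (cball 0 R) x \<partial>lborel)"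
proof -
  let ?B = "cball (0::'a) R"
  have [measurable]: "?B \<in> sets borel" by simp
  have cf: "continuous_on UNIV f" using der
    by (meson continuous_at_imp_continuous_on has_derivative_continuous)
  note [measurable] = borel_measurable_continuous_onI[OF cf] borel_measurable_continuous_onI[OF cont]
  define q where "q z = ennreal (norm (G z) powr p) * indicator ?B z" for z
  have [measurable]: "q \<in> borel_measurable borel" unfolding q_def by measurable
  define K where "K = (\<integral>\<^sup>+z. q z \<partial>lborel)"
  define C where "C = (2 * R) powr p"
  define F where "F y = (\<integral>\<^sup>+x. ennreal (\<bar>f x - f y\<bar> powr p) * indicator ?B x \<partial>lborel)" for y
  have [measurable]: "F \<in> borel_measurable borel" unfolding F_def by measurable
  have seg: "ennreal (\<bar>f x - f y\<bar> powr p) * indicator ?B x * indicator ?B y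
      \<le> (\<integral>\<^sup>+t. ennreal C * q ((1 - t) *\<^sub>R x + t *\<^sub>R y) * indicator {0..1} t * indicator ?B x * indicator ?B y \<partial>lborel)" for x y
  proof (cases "x \<in> ?B \<and> y \<in> ?B")
    case True
    have pt: "x + t *\<^sub>R (y - x) = (1 - t) *\<^sub>R x + t *\<^sub>R y" for t by (simp add: algebra_simps)
    have "ennreal (\<bar>f (x + 1 *\<^sub>R (y - x)) - f (x + 0 *\<^sub>R (y - x))\<bar> powr p)
        \<le> (\<integral>\<^sup>+t. ennreal (C * norm (G (x + t *\<^sub>R (y - x))) powr p) * indicator {0..1} t \<partial>lborel)"
    proof (rule abs_diff_powr_le_nn_integral_deriv[OF p has_real_derivative_along_line[OF der]])
      fix t :: real
      have "norm (y - x) \<le> 2 * R" using True norm_triangle_ineq4[of y x] by simp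
      then have "\<bar>G (x + t *\<^sub>R (y - x)) \<bullet> (y - x)\<bar> \<le> norm (G (x + t *\<^sub>R (y - x))) * (2 * R)"
        by (meson Cauchy_Schwarz_ineq2 mult_left_mono norm_ge_zero order_trans)
      then have "\<bar>G (x + t *\<^sub>R (y - x)) \<bullet> (y - x)\<bar> powr p \<le> (norm (G (x + t *\<^sub>R (y - x))) * (2 * R)) powr p"
        using p by (intro powr_mono2) auto
      then show "\<bar>G (x + t *\<^sub>R (y - x)) \<bullet> (y - x)\<bar> powr p \<le> C * norm (G (x + t *\<^sub>R (y - x))) powr p"
        using R by (simp add: powr_mult C_def mult_ac)
    qed (intro continuous_intros continuous_on_compose2[OF cont]; simp)
    also have "\<dots> = (\<integral>\<^sup>+t. ennreal C * q ((1 - t) *\<^sub>R x + t *\<^sub>R y) * indicator {0..1} t \<partial>lborel)"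
    proof (rule nn_integral_cong)
      fix t :: real
      \<comment> \<open>By convexity the segment stays in the ball, so the cut-off inside
        \<open>q\<close> loses nothing.\<close>
      have "(1 - t) *\<^sub>R x + t *\<^sub>R y \<in> ?B" if "t \<in> {0..1}"
        using that True convexD_alt[OF convex_cball, of x 0 R y t] by auto
      then show "ennreal (C * norm (G (x + t *\<^sub>R (y - x))) powr p) * indicator {0..1} t
          = ennreal C * q ((1 - t) *\<^sub>R x + t *\<^sub>R y) * indicator {0..1} t"
        unfolding pt q_def by (auto simp: ennreal_mult' C_def split: split_indicator)
    qed
    finally show ?thesis using True by (simp add: abs_minus_commute)
  qed auto
  \<comment> \<open>For fixed \<open>t\<close>, change variables in whichever endpoint has coefficient at least \<open>1/2\<close>.\<close>
  have slice: "(\<integral>\<^sup>+y. (\<integral>\<^sup>+x. q ((1 - t) *\<^sub>R x + t *\<^sub>R y) * indicator ?B x * indicator ?B y \<partial>lborel) \<partial>lborel)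
      \<le> ennreal (2 ^ DIM('a)) * K * emeasure lborel ?B" if t: "t \<in> {0..1}" for t :: real
  proof -
    have *: "(\<integral>\<^sup>+y. (\<integral>\<^sup>+x. q (s *\<^sub>R x + r *\<^sub>R y) * indicator ?B x * indicator ?B y \<partial>lborel) \<partial>lborel)
      \<le> ennreal (2 ^ DIM('a)) * K * emeasure lborel ?B" if s: "s \<ge> 1/2" for r s :: real
    proof -
      have "(\<integral>\<^sup>+x. q (s *\<^sub>R x + r *\<^sub>R y) * indicator ?B x * indicator ?B y \<partial>lborel)
          \<le> ennreal (2 ^ DIM('a)) * K * indicator ?B y" for y
      proof -
        have "(\<integral>\<^sup>+x. q (s *\<^sub>R x + r *\<^sub>R y) * indicator ?B x * indicator ?B y \<partial>lborel)
          \<le> (\<integral>\<^sup>+x. q (r *\<^sub>R y + s *\<^sub>R x) * indicator ?B y \<partial>lborel)"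
          by (intro nn_integral_mono) (auto split: split_indicator simp: add.commute)
        also have "\<dots> = ennreal (inverse s ^ DIM('a)) * K * indicator ?B y"
          unfolding K_def using s
          by (subst nn_integral_multc) (auto simp: nn_integral_lborel_affine)
        also have "\<dots> \<le> ennreal (2 ^ DIM('a)) * K * indicator ?B y"
          using s le_imp_inverse_le[of "1/2" s] by (intro mult_right_mono ennreal_leI power_mono) auto
        finally show ?thesis .
      qed
      then have "(\<integral>\<^sup>+y. (\<integral>\<^sup>+x. q (s *\<^sub>R x + r *\<^sub>R y) * indicator ?B x * indicator ?B y \<partial>lborel) \<partial>lborel)
          \<le> (\<integral>\<^sup>+y. ennreal (2 ^ DIM('a)) * K * indicator ?B y \<partial>lborel)"
        by (intro nn_integral_mono)
      then show ?thesis by (simp add: nn_integral_cmult_indicator)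
    qed
    show ?thesis
    proof (cases "t \<le> 1/2")
      case True
      then show ?thesis using *[of "1 - t" t] by simp
    next
      case False
      have "(\<integral>\<^sup>+y. (\<integral>\<^sup>+x. q ((1 - t) *\<^sub>R x + t *\<^sub>R y) * indicator ?B x * indicator ?B y \<partial>lborel) \<partial>lborel)
         = (\<integral>\<^sup>+x. (\<integral>\<^sup>+y. q ((1 - t) *\<^sub>R x + t *\<^sub>R y) * indicator ?B x * indicator ?B y \<partial>lborel) \<partial>lborel)"
        by (rule lborel_pair.Fubini') measurable
      then show ?thesis using *[of t "1 - t"] False by (simp add: add.commute mult_ac)
    qed
  qed
  have "(\<integral>\<^sup>+y. F y * indicator ?B y \<partial>lborel)
      = (\<integral>\<^sup>+y. \<integral>\<^sup>+x. ennreal (\<bar>f x - f y\<bar> powr p) * indicator ?B x * indicator ?B y \<partial>lborel \<partial>lborel)"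
    unfolding F_def by (subst nn_integral_multc) auto
  also have "\<dots> \<le> (\<integral>\<^sup>+y. \<integral>\<^sup>+x. \<integral>\<^sup>+t. ennreal C * q ((1 - t) *\<^sub>R x + t *\<^sub>R y) * indicator {0..1} t * indicator ?B x * indicator ?B y \<partial>lborel \<partial>lborel \<partial>lborel)"
    by (intro nn_integral_mono seg)
  also have "\<dots> = (\<integral>\<^sup>+y. \<integral>\<^sup>+t. \<integral>\<^sup>+x. ennreal C * q ((1 - t) *\<^sub>R x + t *\<^sub>R y) * indicator {0..1} t * indicator ?B x * indicator ?B y \<partial>lborel \<partial>lborel \<partial>lborel)"
    by (intro nn_integral_cong lborel_pair.Fubini') measurable
  also have "\<dots> = (\<integral>\<^sup>+t. \<integral>\<^sup>+y. \<integral>\<^sup>+x. ennreal C * q ((1 - t) *\<^sub>R x + t *\<^sub>R y) * indicator {0..1} t * indicator ?B x * indicator ?B y \<partial>lborel \<partial>lborel \<partial>lborel)"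
    by (rule lborel_pair.Fubini') measurable
  also have "\<dots> = (\<integral>\<^sup>+t. ennreal C * indicator {0..1} t *
      (\<integral>\<^sup>+y. \<integral>\<^sup>+x. q ((1 - t) *\<^sub>R x + t *\<^sub>R y) * indicator ?B x * indicator ?B y \<partial>lborel \<partial>lborel) \<partial>lborel)"
    by (intro nn_integral_cong) (simp add: nn_integral_cmult[symmetric] mult_ac)
  also have "\<dots> \<le> (\<integral>\<^sup>+t. ennreal C * (ennreal (2 ^ DIM('a)) * K * emeasure lborel ?B) * indicator {0..1::real} t \<partial>lborel)"
    by (intro nn_integral_mono) (auto split: split_indicator intro!: mult_left_mono slice)
  also have "\<dots> = ennreal (2 ^ DIM('a) * C) * K * emeasure lborel ?B"
  proof -
    have "ennreal (2 ^ DIM('a) * C) = ennreal (2 ^ DIM('a)) * ennreal C"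
      by (rule ennreal_mult) (auto simp: C_def)
    then show ?thesis by (subst nn_integral_cmult_indicator) (auto simp: mult_ac)
  qed
  finally have J: "(\<integral>\<^sup>+y. F y * indicator ?B y \<partial>lborel) \<le> ennreal (2 ^ DIM('a) * C) * K * emeasure lborel ?B" .
  \<comment> \<open>If every \<open>F y\<close> exceeded the bound, integrating over the ball, whose
    measure is positive and finite, would contradict \<open>J\<close>.\<close>
  have "\<exists>y. F y \<le> ennreal (2 ^ DIM('a) * C) * K"
  proof (rule ccontr)
    let ?c = "ennreal (2 ^ DIM('a) * C) * K"
    assume "\<not> ?thesis"
    then have gt: "?c < F y" for y by (simp add: not_le)
    have fin: "emeasure lborel ?B < \<infinity>" by (rule emeasure_lborel_cball_finite)
    have pos: "emeasure lborel ?B > 0"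
      using R by (simp add: emeasure_cball)
    have "(\<integral>\<^sup>+y. ?c * indicator ?B y \<partial>lborel) < (\<integral>\<^sup>+y. F y * indicator ?B y \<partial>lborel)"
    proof (rule nn_integral_less)
      have "?c < \<infinity>" using less_le_trans[OF gt[of 0] top_greatest] by simp
      then have "?c * emeasure lborel ?B < \<infinity>" using fin by (simp add: ennreal_mult_less_top)
      then show "(\<integral>\<^sup>+y. ?c * indicator ?B y \<partial>lborel) \<noteq> \<infinity>"
        by (subst nn_integral_cmult_indicator) auto
      show "\<not> (AE y in lborel. F y * indicator ?B y \<le> ?c * indicator ?B y)"
      proof
        assume "AE y in lborel. F y * indicator ?B y \<le> ?c * indicator ?B y"
        then have "AE y in lborel. y \<notin> ?B"
        proof eventually_elim
          case (elim y)
          then show ?case using gt[of y] by (cases "y \<in> ?B") (simp_all add: leD)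
        qed
        then have "?B \<in> null_sets lborel" by (subst AE_iff_null_sets) auto
        then show False using pos by (simp add: null_sets_def)
      qed
      show "AE y in lborel. ?c * indicator ?B y \<le> F y * indicator ?B y"
        using gt by (intro AE_I2 mult_right_mono) (auto intro: less_imp_le)
    qed measurable
    also have "(\<integral>\<^sup>+y. ?c * indicator ?B y \<partial>lborel) = ?c * emeasure lborel ?B"
      by (rule nn_integral_cmult_indicator) auto
    finally show False using J by simp
  qed
  then show ?thesis using that unfolding F_def K_def q_def C_def by blast
qed

subsection \<open>Hardy inequalities by dilation\<close>

text \<open>Cancelling \<theta> A on both sides is legitimate only for finite A; for \<theta> > 0 an
  infinite A would satisfy the first assumption whatever B is.\<close>

lemma ennreal_absorb:
  fixes A B :: ennreal
  assumes "A \<le> ennreal \<theta> * A + B" "0 \<le> \<theta>" "\<theta> < 1" "A < \<infinity>"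
  shows "A \<le> ennreal (1 / (1 - \<theta>)) * B"
proof (cases B)
  case (real r)
  obtain a where a: "A = ennreal a" "a \<ge> 0" using assms(4) by (cases A) auto
  have "ennreal a \<le> ennreal (\<theta> * a + r)"
    using assms a real by (simp add: ennreal_mult)
  then have "a \<le> \<theta> * a + r" using assms a real by (subst (asm) ennreal_le_iff) auto
  then have "a \<le> 1 / (1 - \<theta>) * r" using assms by (simp add: field_simps)
  then show ?thesis using a real assms by (simp add: ennreal_mult[symmetric] ennreal_leI)
next
  case top
  then show ?thesis using assms by (simp add: ennreal_mult_top)
qed

text \<open>\<open>\<Psi>\<close> plays the role of \<open>|\<nabla>\<Phi>|\<close>.\<close>

definition ray_bound :: "('a::euclidean_space \<Rightarrow> real) \<Rightarrow> ('a \<Rightarrow> real) \<Rightarrow> bool" where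
  "ray_bound \<Phi> \<Psi> \<longleftrightarrow> \<Phi> \<in> borel_measurable borel \<and> \<Psi> \<in> borel_measurable borel \<and> (\<forall>x. 0 \<le> \<Phi> x)
     \<and> (\<forall>x \<alpha> \<beta>. 0 < \<alpha> \<longrightarrow> \<alpha> \<le> \<beta> \<longrightarrow> ennreal \<bar>\<Phi> (\<beta> *\<^sub>R x) - \<Phi> (\<alpha> *\<^sub>R x)\<bar>
          \<le> (\<integral>\<^sup>+t. ennreal (norm x) * ennreal (\<Psi> (t *\<^sub>R x)) * indicator {\<alpha>..\<beta>} t \<partial>lborel))"

lemma borel_measurable_ray_bound:
  assumes "ray_bound \<Phi> \<Psi>"
  shows "\<Phi> \<in> borel_measurable borel" "\<Psi> \<in> borel_measurable borel"
  using assms by (auto simp: ray_bound_def)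

text \<open>Comparing \<open>\<Phi>\<close> with its dilation by the factor \<open>l\<close> gives a Hardy inequality for every weight
  whose dilation is, up to the remainder \<open>m\<close>, a contraction; the contraction is absorbed, which is
  why finiteness is needed.\<close>

lemma Hardy_dilation:
  fixes w m n :: "'a::euclidean_space \<Rightarrow> ennreal" and \<Phi> \<Psi> :: "'a \<Rightarrow> real"
  assumes rb: "ray_bound \<Phi> \<Psi>"
    and meas: "w \<in> borel_measurable borel" "m \<in> borel_measurable borel" "n \<in> borel_measurable borel"
    and l: "l > 0" and \<theta>: "0 \<le> \<theta>" "\<theta> < 1"
    and contr: "\<And>x. x \<noteq> 0 \<Longrightarrow> ennreal (inverse l ^ DIM('a)) * w (inverse l *\<^sub>R x) \<le> ennreal \<theta> * w x + m x"
    and kernel: "\<And>z. z \<noteq> 0 \<Longrightarrow>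
      (\<integral>\<^sup>+t. ennreal (inverse t ^ Suc DIM('a)) * w (inverse t *\<^sub>R z) * indicator {min 1 l..max 1 l} t \<partial>lborel) \<le> n z"
    and fin: "(\<integral>\<^sup>+x. ennreal (\<Phi> x) * w x \<partial>lborel) < \<infinity>"
  shows "(\<integral>\<^sup>+x. ennreal (\<Phi> x) * w x \<partial>lborel)
    \<le> ennreal (1 / (1 - \<theta>)) * ((\<integral>\<^sup>+x. ennreal (\<Phi> x) * m x \<partial>lborel) + (\<integral>\<^sup>+x. ennreal (norm x) * ennreal (\<Psi> x) * n x \<partial>lborel))"
proof (rule ennreal_absorb[OF _ \<theta> fin])
  have [measurable]: "\<Phi> \<in> borel_measurable borel" "\<Psi> \<in> borel_measurable borel" and \<Phi>0: "\<And>x. 0 \<le> \<Phi> x"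
    using rb by (auto simp: ray_bound_def)
  note [measurable] = meas
  \<comment> \<open>The interval between 1 and l in either order, so that one argument covers
    dilation by 2 and by 1/2.\<close>
  let ?I = "{min 1 l..max 1 l}"
  have nz: "AE x in lborel. x \<noteq> (0::'a)" by (rule AE_lborel_singleton)
  have pt: "ennreal (\<Phi> x) \<le> ennreal (\<Phi> (l *\<^sub>R x)) +
      (\<integral>\<^sup>+t. ennreal (norm x) * ennreal (\<Psi> (t *\<^sub>R x)) * indicator ?I t \<partial>lborel)" for x
  proof -
    have "ennreal \<bar>\<Phi> (max 1 l *\<^sub>R x) - \<Phi> (min 1 l *\<^sub>R x)\<bar>
        \<le> (\<integral>\<^sup>+t. ennreal (norm x) * ennreal (\<Psi> (t *\<^sub>R x)) * indicator ?I t \<partial>lborel)"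
      using rb l unfolding ray_bound_def by auto
    moreover have "\<bar>\<Phi> (max 1 l *\<^sub>R x) - \<Phi> (min 1 l *\<^sub>R x)\<bar> = \<bar>\<Phi> x - \<Phi> (l *\<^sub>R x)\<bar>"
      by (simp add: max_def min_def abs_minus_commute)
    moreover have "ennreal (\<Phi> x) \<le> ennreal (\<Phi> (l *\<^sub>R x)) + ennreal \<bar>\<Phi> x - \<Phi> (l *\<^sub>R x)\<bar>"
      using \<Phi>0 by (simp add: ennreal_plus[symmetric] del: ennreal_plus)
    ultimately show ?thesis by (auto elim!: order_trans intro!: add_left_mono)
  qed
  have "(\<integral>\<^sup>+x. ennreal (\<Phi> x) * w x \<partial>lborel)
      \<le> (\<integral>\<^sup>+x. ennreal (\<Phi> (l *\<^sub>R x)) * w x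
          + w x * (\<integral>\<^sup>+t. ennreal (norm x) * ennreal (\<Psi> (t *\<^sub>R x)) * indicator ?I t \<partial>lborel) \<partial>lborel)"
  proof (rule nn_integral_mono)
    fix x
    show "ennreal (\<Phi> x) * w x \<le> ennreal (\<Phi> (l *\<^sub>R x)) * w x
          + w x * (\<integral>\<^sup>+t. ennreal (norm x) * ennreal (\<Psi> (t *\<^sub>R x)) * indicator ?I t \<partial>lborel)"
      using mult_left_mono[OF pt[of x], of "w x"] by (simp add: distrib_left mult.commute)
  qed
  also have "\<dots> = (\<integral>\<^sup>+x. ennreal (\<Phi> (l *\<^sub>R x)) * w x \<partial>lborel)
      + (\<integral>\<^sup>+x. w x * (\<integral>\<^sup>+t. ennreal (norm x) * ennreal (\<Psi> (t *\<^sub>R x)) * indicator ?I t \<partial>lborel) \<partial>lborel)"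
    by (rule nn_integral_add) measurable
  finally have split: "(\<integral>\<^sup>+x. ennreal (\<Phi> x) * w x \<partial>lborel) \<le> (\<integral>\<^sup>+x. ennreal (\<Phi> (l *\<^sub>R x)) * w x \<partial>lborel)
      + (\<integral>\<^sup>+x. w x * (\<integral>\<^sup>+t. ennreal (norm x) * ennreal (\<Psi> (t *\<^sub>R x)) * indicator ?I t \<partial>lborel) \<partial>lborel)" .
  \<comment> \<open>The substitution x -> l x moves the dilation from \<Phi> onto the weight, where
    \<open>contr\<close> applies.\<close>
  have dil: "(\<integral>\<^sup>+x. ennreal (\<Phi> (l *\<^sub>R x)) * w x \<partial>lborel)
      \<le> ennreal \<theta> * (\<integral>\<^sup>+x. ennreal (\<Phi> x) * w x \<partial>lborel) + (\<integral>\<^sup>+x. ennreal (\<Phi> x) * m x \<partial>lborel)"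
  proof -
    let ?g = "\<lambda>z. ennreal (\<Phi> z) * w (inverse l *\<^sub>R z)"
    have "(\<integral>\<^sup>+x. ennreal (\<Phi> (l *\<^sub>R x)) * w x \<partial>lborel) = (\<integral>\<^sup>+x. ?g (0 + l *\<^sub>R x) \<partial>lborel)"
      using l by simp
    also have "\<dots> = ennreal (inverse l ^ DIM('a)) * (\<integral>\<^sup>+x. ?g x \<partial>lborel)"
      using l by (intro nn_integral_lborel_affine) auto
    also have "\<dots> = (\<integral>\<^sup>+x. ennreal (\<Phi> x) * (ennreal (inverse l ^ DIM('a)) * w (inverse l *\<^sub>R x)) \<partial>lborel)"
      by (subst nn_integral_cmult[symmetric]) (auto simp: mult_ac)
    also have "\<dots> \<le> (\<integral>\<^sup>+x. ennreal (\<Phi> x) * (ennreal \<theta> * w x + m x) \<partial>lborel)"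
      by (rule nn_integral_mono_AE) (use nz in eventually_elim, intro mult_left_mono contr, auto)
    also have "\<dots> = (\<integral>\<^sup>+x. ennreal \<theta> * (ennreal (\<Phi> x) * w x) + ennreal (\<Phi> x) * m x \<partial>lborel)"
      by (intro nn_integral_cong) (simp add: distrib_left mult_ac)
    also have "\<dots> = ennreal \<theta> * (\<integral>\<^sup>+x. ennreal (\<Phi> x) * w x \<partial>lborel) + (\<integral>\<^sup>+x. ennreal (\<Phi> x) * m x \<partial>lborel)"
      by (subst nn_integral_add) (auto simp: nn_integral_cmult)
    finally show ?thesis .
  qed
  have ker: "(\<integral>\<^sup>+x. w x * (\<integral>\<^sup>+t. ennreal (norm x) * ennreal (\<Psi> (t *\<^sub>R x)) * indicator ?I t \<partial>lborel) \<partial>lborel)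
      \<le> (\<integral>\<^sup>+x. ennreal (norm x) * ennreal (\<Psi> x) * n x \<partial>lborel)"
  proof -
    have "(\<integral>\<^sup>+x. w x * (\<integral>\<^sup>+t. ennreal (norm x) * ennreal (\<Psi> (t *\<^sub>R x)) * indicator ?I t \<partial>lborel) \<partial>lborel)
      = (\<integral>\<^sup>+z. ennreal (norm z) * ennreal (\<Psi> z) *
        (\<integral>\<^sup>+t. ennreal (inverse t ^ Suc DIM('a)) * w (inverse t *\<^sub>R z) * indicator ?I t \<partial>lborel) \<partial>lborel)"
      by (rule nn_integral_dilation_kernel) (use l in auto)
    also have "\<dots> \<le> (\<integral>\<^sup>+x. ennreal (norm x) * ennreal (\<Psi> x) * n x \<partial>lborel)"
      by (rule nn_integral_mono_AE) (use nz in eventually_elim, intro mult_left_mono kernel, auto)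
    finally show ?thesis .
  qed
  show "(\<integral>\<^sup>+x. ennreal (\<Phi> x) * w x \<partial>lborel)
      \<le> ennreal \<theta> * (\<integral>\<^sup>+x. ennreal (\<Phi> x) * w x \<partial>lborel) +
        ((\<integral>\<^sup>+x. ennreal (\<Phi> x) * m x \<partial>lborel) + (\<integral>\<^sup>+x. ennreal (norm x) * ennreal (\<Psi> x) * n x \<partial>lborel))"
    using order_trans[OF split add_mono[OF dil ker]] by (simp only: add.assoc)
qed

text \<open>Chain rule along rays and Cauchy-Schwarz. This is the instance to which the Hardy
  inequality is applied.\<close>

lemma ray_bound_abs_powr:
  fixes f :: "'a::euclidean_space \<Rightarrow> real" and G :: "'a \<Rightarrow> 'a"
  assumes p: "1 < p"
    and der: "\<And>x. (f has_derivative (\<lambda>h. G x \<bullet> h)) (at x)" and cont: "continuous_on UNIV G"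
  shows "ray_bound (\<lambda>x. \<bar>f x - c\<bar> powr p) (\<lambda>x. p * \<bar>f x - c\<bar> powr (p - 1) * norm (G x))"
proof -
  have cf: "continuous_on UNIV f" using der
    by (meson continuous_at_imp_continuous_on has_derivative_continuous)
  have "ennreal \<bar>\<bar>f (\<beta> *\<^sub>R x) - c\<bar> powr p - \<bar>f (\<alpha> *\<^sub>R x) - c\<bar> powr p\<bar>
      \<le> (\<integral>\<^sup>+t. ennreal (norm x) * ennreal (p * \<bar>f (t *\<^sub>R x) - c\<bar> powr (p - 1) * norm (G (t *\<^sub>R x))) * indicator {\<alpha>..\<beta>} t \<partial>lborel)"
    if "0 < \<alpha>" "\<alpha> \<le> \<beta>" for x and \<alpha> \<beta> :: real
  proof -
    let ?\<psi>' = "\<lambda>t. p * \<bar>f (t *\<^sub>R x) - c\<bar> powr (p - 1) * sgn (f (t *\<^sub>R x) - c) * (G (t *\<^sub>R x) \<bullet> x)"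
    have ray: "((\<lambda>t. f (t *\<^sub>R x) - c) has_real_derivative G (t *\<^sub>R x) \<bullet> x) (at t)" for t
      using has_real_derivative_along_line[OF der, of 0 x t] by (auto intro!: derivative_eq_intros)
    have "ennreal \<bar>\<bar>f (\<beta> *\<^sub>R x) - c\<bar> powr p - \<bar>f (\<alpha> *\<^sub>R x) - c\<bar> powr p\<bar>
      \<le> (\<integral>\<^sup>+t. ennreal (norm x * (p * \<bar>f (t *\<^sub>R x) - c\<bar> powr (p - 1) * norm (G (t *\<^sub>R x)))) * indicator {\<alpha>..\<beta>} t \<partial>lborel)"
    proof (rule abs_diff_le_nn_integral_deriv[where \<psi>'="?\<psi>'"])
      fix t :: real
      show "((\<lambda>t. \<bar>f (t *\<^sub>R x) - c\<bar> powr p) has_real_derivative ?\<psi>' t) (at t)"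
        using DERIV_chain2[OF has_real_derivative_abs_powr[OF p] ray] by simp
      have "\<bar>?\<psi>' t\<bar> \<le> p * \<bar>f (t *\<^sub>R x) - c\<bar> powr (p - 1) * 1 * (norm (G (t *\<^sub>R x)) * norm x)"
        unfolding abs_mult using p Cauchy_Schwarz_ineq2[of "G (t *\<^sub>R x)" x]
        by (intro mult_mono) (auto simp: abs_sgn_eq)
      then show "\<bar>?\<psi>' t\<bar> \<le> norm x * (p * \<bar>f (t *\<^sub>R x) - c\<bar> powr (p - 1) * norm (G (t *\<^sub>R x)))"
        by (simp add: mult_ac)
      \<comment> \<open>Grouping \<open>sgn\<close> with the power keeps the derivative continuous
        across zeros of f - c.\<close>
      have "continuous_on {\<alpha>..\<beta>} (\<lambda>t. p * ((\<lambda>s. \<bar>s\<bar> powr (p - 1) * sgn s) (f (t *\<^sub>R x) - c)) * (G (t *\<^sub>R x) \<bullet> x))"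
        by (intro continuous_intros continuous_on_compose2[OF continuous_on_sgn_powr] continuous_on_compose2[OF cf] continuous_on_compose2[OF cont]) (use p in auto)
      then show "continuous_on {\<alpha>..\<beta>} ?\<psi>'" by (simp add: mult_ac)
    qed fact
    also have "\<dots> = (\<integral>\<^sup>+t. ennreal (norm x) * ennreal (p * \<bar>f (t *\<^sub>R x) - c\<bar> powr (p - 1) * norm (G (t *\<^sub>R x))) * indicator {\<alpha>..\<beta>} t \<partial>lborel)"
      using p by (intro nn_integral_cong) (simp add: ennreal_mult)
    finally show ?thesis .
  qed
  moreover note [measurable] = borel_measurable_continuous_onI[OF cf] borel_measurable_continuous_onI[OF cont]
  ultimately show ?thesis unfolding ray_bound_def by auto
qed

section \<open>Hardy inequalities for the exponential weight\<close>

text \<open>For k = \<mu> p / \<gamma> this is |x|^(-\<sigma>) v^p with v = exp (-\<mu> |x|^\<gamma>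
  / \<gamma>), so the exponents pa and pb give the two weights of the Poincare inequality for u /
  v.\<close>

definition exp_weight :: "real \<Rightarrow> real \<Rightarrow> real \<Rightarrow> 'a::real_normed_vector \<Rightarrow> real" where
  "exp_weight \<sigma> \<gamma> k x = norm x powr (- \<sigma>) * exp (- k * norm x powr \<gamma>)"

lemma exp_weight_nonneg: "0 \<le> exp_weight \<sigma> \<gamma> k x"
  by (simp add: exp_weight_def)

lemma borel_measurable_exp_weight [measurable (raw)]:
  fixes g :: "'b \<Rightarrow> 'a::euclidean_space"
  assumes [measurable]: "g \<in> borel_measurable M"
  shows "(\<lambda>x. exp_weight \<sigma> \<gamma> k (g x)) \<in> borel_measurable M"
  unfolding exp_weight_def by measurable

text \<open>Dilation by 2 gains 2^\<sigma> from the weight |x|^(-\<sigma>) and loses the Jacobian, a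
  contraction because \<sigma> is below the dimension. The dilated weight spills into the annulus r
  < |x| <= 2r, whence the term on the larger ball. The exponential lies between positive constants
  on bounded sets, so a truncated pure power can serve as the weight.\<close>

lemma Hardy_near_origin:
  fixes \<Phi> \<Psi> :: "'a::euclidean_space \<Rightarrow> real" and \<sigma> \<gamma> k r :: real
  assumes \<sigma>: "0 \<le> \<sigma>" "\<sigma> < DIM('a)" and \<gamma>: "0 < \<gamma>" and k: "0 < k" and r: "0 < r"
    and rb: "ray_bound \<Phi> \<Psi>"
    and fin: "(\<integral>\<^sup>+x. ennreal (\<Phi> x) * ennreal (exp_weight \<sigma> \<gamma> k x) \<partial>lborel) < \<infinity>"
  shows "(\<integral>\<^sup>+x. ennreal (\<Phi> x) * (ennreal (norm x powr (- \<sigma>)) * indicator (cball 0 r) x) \<partial>lborel)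
    \<le> ennreal (1 / (1 - 2 powr (\<sigma> - DIM('a)))) *
      ((\<integral>\<^sup>+x. ennreal (\<Phi> x) * (ennreal (r powr (-\<sigma>)) * indicator (cball 0 (2 * r)) x) \<partial>lborel)
      + (\<integral>\<^sup>+x. ennreal (norm x) * ennreal (\<Psi> x) *
          ennreal (2 powr \<sigma> * (2 * r) powr \<gamma> * exp (k * (2 * r) powr \<gamma>) * (norm x powr (-\<gamma>) * exp_weight \<sigma> \<gamma> k x)) \<partial>lborel))"
proof (rule Hardy_dilation[OF rb, where l = 2])
  let ?w = "\<lambda>x::'a. ennreal (norm x powr (- \<sigma>)) * indicator (cball 0 r) x"
  let ?\<theta> = "2 powr (\<sigma> - DIM('a))"
  have "?\<theta> < 2 powr 0" using \<sigma> by (intro powr_less_mono) auto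
  then show \<theta>1: "?\<theta> < 1" by simp
  have dil: "norm (inverse t *\<^sub>R x) powr (- \<sigma>) = t powr \<sigma> * norm x powr (-\<sigma>)" if "t > 0" for t and x :: 'a
    using that by (simp add: powr_mult powr_minus powr_divide field_simps)
  show "ennreal (inverse 2 ^ DIM('a)) * ?w (inverse 2 *\<^sub>R x)
      \<le> ennreal ?\<theta> * ?w x + ennreal (r powr (-\<sigma>)) * indicator (cball 0 (2 * r)) x" if x: "x \<noteq> 0" for x :: 'a
  proof -
    have e: "ennreal (inverse 2 ^ DIM('a)) * ennreal (norm (inverse 2 *\<^sub>R x) powr (- \<sigma>))
        = ennreal ?\<theta> * ennreal (norm x powr (-\<sigma>))"
      unfolding dil[OF zero_less_numeral]
      by (simp add: ennreal_mult'[symmetric] powr_diff powr_realpow[symmetric] power_inverse field_simps)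
    consider "norm x \<le> r" | "r < norm x" "norm x \<le> 2 * r" | "2 * r < norm x" by linarith
    then show ?thesis
    proof cases
      case 1
      then have "inverse 2 *\<^sub>R x \<in> cball 0 r" "x \<in> cball 0 r" using r by simp_all
      then have "ennreal (inverse 2 ^ DIM('a)) * ?w (inverse 2 *\<^sub>R x) = ennreal ?\<theta> * ?w x"
        using e by (simp only: simp_thms indicator_simps mult_1_right)
      then show ?thesis by simp
    next
      \<comment> \<open>Only the dilated weight lives on this annulus; being at most r^(-\<sigma>),
        it goes into the remainder.\<close>
      case 2
      have "norm x powr (-\<sigma>) \<le> r powr (-\<sigma>)" using 2 r \<sigma> by (intro powr_mono2') auto
      then have "?\<theta> * norm x powr (-\<sigma>) \<le> 1 * r powr (-\<sigma>)" using \<theta>1 by (intro mult_mono) auto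
      then have "ennreal (?\<theta> * norm x powr (-\<sigma>)) \<le> ennreal (r powr (-\<sigma>))"
        by (intro ennreal_leI) simp
      then have A: "ennreal ?\<theta> * ennreal (norm x powr (-\<sigma>)) \<le> ennreal (r powr (-\<sigma>))"
        by (simp only: ennreal_mult'' powr_ge_zero)
      have B: "ennreal (inverse 2 ^ DIM('a)) * ?w (inverse 2 *\<^sub>R x)
          \<le> ennreal (inverse 2 ^ DIM('a)) * ennreal (norm (inverse 2 *\<^sub>R x) powr (-\<sigma>))"
        by (intro mult_left_mono) (auto simp: indicator_def)
      have "x \<notin> cball 0 r" "x \<in> cball 0 (2 * r)" using 2 by simp_all
      then show ?thesis using order_trans[OF B[unfolded e] A]
        by (simp only: simp_thms indicator_simps mult_1_right mult_zero_right add_0)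
    next
      case 3
      then have "inverse 2 *\<^sub>R x \<notin> cball 0 r" by simp
      then show ?thesis by (simp only: simp_thms indicator_simps mult_zero_right zero_le)
    qed
  qed
  show "(\<integral>\<^sup>+t. ennreal (inverse t ^ Suc DIM('a)) * ?w (inverse t *\<^sub>R z) * indicator {min 1 2..max 1 2} t \<partial>lborel)
    \<le> ennreal (2 powr \<sigma> * (2 * r) powr \<gamma> * exp (k * (2 * r) powr \<gamma>) * (norm z powr (-\<gamma>) * exp_weight \<sigma> \<gamma> k z))"
    (is "_ \<le> ?n") if z: "z \<noteq> 0" for z :: 'a
  proof -
    have "ennreal (inverse t ^ Suc DIM('a)) * ?w (inverse t *\<^sub>R z) * indicator {min 1 2..max 1 2} t
        \<le> ?n * indicator {1..2} t" for t :: real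
    proof (cases "t \<in> {1..2} \<and> norm (inverse t *\<^sub>R z) \<le> r")
      case True
      then have t: "1 \<le> t" "t \<le> 2" by auto
      have "norm z / t \<le> r" using True t by (simp add: divide_inverse mult.commute)
      then have zr: "norm z \<le> t * r" using t by (simp add: pos_divide_le_eq mult.commute)
      have z2: "norm z \<le> 2 * r" using zr t r mult_right_mono[of t 2 r] by linarith
      \<comment> \<open>The factors |z|^\<gamma> and exp (k |z|^\<gamma>) are bounded for |z| <= 2r.
        Inserting them gives the gradient term the same weight as the estimate near infinity, where
        the factor |z|^(-\<gamma>) arises by itself.\<close>
      have "norm z powr (-\<sigma>) = norm z powr \<gamma> * exp (k * norm z powr \<gamma>) * (norm z powr (-\<gamma>) * exp_weight \<sigma> \<gamma> k z)"
        using z by (simp add: exp_weight_def exp_minus powr_minus field_simps)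
      also have "\<dots> \<le> (2 * r) powr \<gamma> * exp (k * (2 * r) powr \<gamma>) * (norm z powr (-\<gamma>) * exp_weight \<sigma> \<gamma> k z)"
        using z2 \<gamma> k r exp_weight_nonneg
        by (intro mult_right_mono mult_mono) (auto intro!: powr_mono2 mult_left_mono)
      finally have a: "norm z powr (-\<sigma>) \<le> \<dots>" .
      have "inverse t ^ Suc DIM('a) * (t powr \<sigma> * norm z powr (-\<sigma>)) \<le> 1 * (2 powr \<sigma> * norm z powr (-\<sigma>))"
      proof (rule mult_mono)
        show "inverse t ^ Suc DIM('a) \<le> 1" using t by (intro power_le_one) (auto simp: inverse_le_1_iff)
        show "t powr \<sigma> * norm z powr (-\<sigma>) \<le> 2 powr \<sigma> * norm z powr (-\<sigma>)"
          using t \<sigma> by (intro mult_right_mono powr_mono2) auto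
      qed (use t in auto)
      also have "\<dots> \<le> 2 powr \<sigma> * (2 * r) powr \<gamma> * exp (k * (2 * r) powr \<gamma>) * (norm z powr (-\<gamma>) * exp_weight \<sigma> \<gamma> k z)"
        using mult_left_mono[OF a, of "2 powr \<sigma>"] by (simp add: mult.assoc)
      finally have "ennreal (inverse t ^ Suc DIM('a) * (t powr \<sigma> * norm z powr (-\<sigma>))) \<le> ?n" by (rule ennreal_leI)
      moreover have "ennreal (inverse t ^ Suc DIM('a)) * ?w (inverse t *\<^sub>R z) * indicator {min 1 2..max 1 2} t
          = ennreal (inverse t ^ Suc DIM('a) * (t powr \<sigma> * norm z powr (-\<sigma>)))"
        using True dil[of t z] t by (simp del: norm_scaleR power_Suc add: ennreal_mult)
      ultimately show ?thesis using t by simp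
    qed (auto split: split_indicator)
    then have "(\<integral>\<^sup>+t. ennreal (inverse t ^ Suc DIM('a)) * ?w (inverse t *\<^sub>R z) * indicator {min 1 2..max 1 2} t \<partial>lborel)
        \<le> (\<integral>\<^sup>+t. ?n * indicator {1..2::real} t \<partial>lborel)"
      by (intro nn_integral_mono)
    also have "\<dots> = ?n" by (subst nn_integral_cmult_indicator) auto
    finally show ?thesis .
  qed
  note [measurable] = borel_measurable_ray_bound[OF rb]
  \<comment> \<open>Finiteness carries over because the truncated power is at most exp (k
    r^\<gamma>) times the full weight.\<close>
  have "(\<integral>\<^sup>+x. ennreal (\<Phi> x) * ?w x \<partial>lborel)
      \<le> (\<integral>\<^sup>+x. ennreal (exp (k * r powr \<gamma>)) * (ennreal (\<Phi> x) * ennreal (exp_weight \<sigma> \<gamma> k x)) \<partial>lborel)"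
  proof (intro nn_integral_mono)
    fix x :: 'a
    have "?w x \<le> ennreal (exp (k * r powr \<gamma>) * exp_weight \<sigma> \<gamma> k x)"
    proof (cases "norm x \<le> r")
      case True
      have "norm x powr (-\<sigma>) = exp (k * norm x powr \<gamma>) * exp_weight \<sigma> \<gamma> k x"
        by (simp add: exp_weight_def exp_minus field_simps)
      also have "\<dots> \<le> exp (k * r powr \<gamma>) * exp_weight \<sigma> \<gamma> k x"
        using True k \<gamma> exp_weight_nonneg by (intro mult_right_mono) (auto intro!: powr_mono2 mult_left_mono)
      finally show ?thesis using True by (auto intro!: ennreal_leI)
    qed auto
    then have "ennreal (\<Phi> x) * ?w x \<le> ennreal (\<Phi> x) * ennreal (exp (k * r powr \<gamma>) * exp_weight \<sigma> \<gamma> k x)"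
      by (intro mult_left_mono) auto
    also have "\<dots> = ennreal (exp (k * r powr \<gamma>)) * (ennreal (\<Phi> x) * ennreal (exp_weight \<sigma> \<gamma> k x))"
      by (simp add: ennreal_mult exp_weight_nonneg mult_ac)
    finally show "ennreal (\<Phi> x) * ?w x \<le> \<dots>" .
  qed
  also have "\<dots> = ennreal (exp (k * r powr \<gamma>)) * (\<integral>\<^sup>+x. ennreal (\<Phi> x) * ennreal (exp_weight \<sigma> \<gamma> k x) \<partial>lborel)"
    by (rule nn_integral_cmult) simp
  also have "\<dots> < \<infinity>" using fin by (simp add: ennreal_mult_less_top)
  finally show "(\<integral>\<^sup>+x. ennreal (\<Phi> x) * ?w x \<partial>lborel) < \<infinity>" .
  have [measurable]: "cball (0::'a) s \<in> sets borel" for s by simp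
  show "?w \<in> borel_measurable borel" by measurable
  show "(\<lambda>x. ennreal (r powr (-\<sigma>)) * indicator (cball 0 (2 * r)) x) \<in> borel_measurable (borel :: 'a measure)"
    by measurable
  show "(\<lambda>x. ennreal (2 powr \<sigma> * (2 * r) powr \<gamma> * exp (k * (2 * r) powr \<gamma>)
      * (norm x powr (-\<gamma>) * exp_weight \<sigma> \<gamma> k x))) \<in> borel_measurable (borel :: 'a measure)"
    by measurable
qed simp_all

text \<open>Dilation by 1/2 compares the weight at 2x with the weight at x. Beyond radius r the
  exponential shrinks by at least exp (-k (2^\<gamma> - 1) r^\<gamma>), and \<open>large\<close>
  says that this beats the Jacobian. Integrating the exponential over the dilation factor t gains 1
  / (k \<gamma> |z|^\<gamma>): this is the source of the factor |x|^(-\<gamma>) in the gradient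
  term.\<close>

lemma Hardy_near_infinity:
  fixes \<Phi> \<Psi> :: "'a::euclidean_space \<Rightarrow> real" and \<sigma> \<gamma> k r :: real
  assumes \<sigma>: "0 \<le> \<sigma>" and \<gamma>: "0 < \<gamma>" and k: "0 < k" and r: "0 < r"
    and large: "2 ^ DIM('a) * exp (- k * (2 powr \<gamma> - 1) * r powr \<gamma>) \<le> 1 / 2"
    and rb: "ray_bound \<Phi> \<Psi>"
    and fin: "(\<integral>\<^sup>+x. ennreal (\<Phi> x) * ennreal (exp_weight \<sigma> \<gamma> k x) \<partial>lborel) < \<infinity>"
  shows "(\<integral>\<^sup>+x. ennreal (\<Phi> x) * (ennreal (exp_weight \<sigma> \<gamma> k x) * indicator (- cball 0 (2 * r)) x) \<partial>lborel)
    \<le> ennreal (1 / (1 - 1 / 2)) *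
      ((\<integral>\<^sup>+x. ennreal (\<Phi> x) * (ennreal (r powr (-\<sigma>)) * indicator (cball 0 (2 * r)) x) \<partial>lborel)
      + (\<integral>\<^sup>+x. ennreal (norm x) * ennreal (\<Psi> x) *
          ennreal (2 ^ Suc DIM('a) / (k * \<gamma>) * (norm x powr (-\<gamma>) * exp_weight \<sigma> \<gamma> k x)) \<partial>lborel))"
proof (rule Hardy_dilation[OF rb, where l = "1/2"])
  let ?w = "\<lambda>x::'a. ennreal (exp_weight \<sigma> \<gamma> k x) * indicator (- cball 0 (2 * r)) x"
  have Wle: "exp_weight \<sigma> \<gamma> k x \<le> r powr (-\<sigma>)" if "r < norm x" for x :: 'a
  proof -
    have "exp_weight \<sigma> \<gamma> k x \<le> norm x powr (-\<sigma>) * 1"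
      unfolding exp_weight_def using k by (intro mult_left_mono) auto
    also have "\<dots> \<le> r powr (-\<sigma>)" using that r \<sigma> by (auto intro: powr_mono2')
    finally show ?thesis .
  qed
  show "ennreal (inverse (1/2) ^ DIM('a)) * ?w (inverse (1/2) *\<^sub>R x)
      \<le> ennreal (1/2) * ?w x + ennreal (r powr (-\<sigma>)) * indicator (cball 0 (2 * r)) x" if x: "x \<noteq> 0" for x :: 'a
  proof (cases "norm x \<le> r")
    case False
    have "norm (2 *\<^sub>R x) powr (-\<sigma>) \<le> norm x powr (-\<sigma>)"
      using x \<sigma> by (intro powr_mono2') auto
    moreover have "exp (- k * norm (2 *\<^sub>R x) powr \<gamma>) \<le> exp (- k * (2 powr \<gamma> - 1) * r powr \<gamma>) * exp (- k * norm x powr \<gamma>)"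
    proof -
      have "2 powr \<gamma> \<ge> 1" using \<gamma> by (simp add: ge_one_powr_ge_zero)
      moreover have "r powr \<gamma> \<le> norm x powr \<gamma>" using False r \<gamma> by (intro powr_mono2) auto
      ultimately have "k * (2 powr \<gamma> - 1) * r powr \<gamma> \<le> k * (2 powr \<gamma> - 1) * norm x powr \<gamma>"
        using k by (intro mult_left_mono) auto
      then show ?thesis by (simp add: exp_add[symmetric] powr_mult algebra_simps)
    qed
    ultimately have "exp_weight \<sigma> \<gamma> k (2 *\<^sub>R x) \<le> norm x powr (-\<sigma>) * (exp (- k * (2 powr \<gamma> - 1) * r powr \<gamma>) * exp (- k * norm x powr \<gamma>))"
      unfolding exp_weight_def by (intro mult_mono) auto
    then have "2 ^ DIM('a) * exp_weight \<sigma> \<gamma> k (2 *\<^sub>R x) \<le> 2 ^ DIM('a) * \<dots>" by (intro mult_left_mono) auto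
    also have "\<dots> = (2 ^ DIM('a) * exp (- k * (2 powr \<gamma> - 1) * r powr \<gamma>)) * exp_weight \<sigma> \<gamma> k x"
      by (simp add: exp_weight_def)
    also have "\<dots> \<le> 1/2 * exp_weight \<sigma> \<gamma> k x" by (intro mult_right_mono large exp_weight_nonneg)
    finally have "ennreal (2 ^ DIM('a) * exp_weight \<sigma> \<gamma> k (2 *\<^sub>R x)) \<le> ennreal (1/2 * exp_weight \<sigma> \<gamma> k x)"
      by (rule ennreal_leI)
    then have a: "ennreal (2 ^ DIM('a)) * ennreal (exp_weight \<sigma> \<gamma> k (2 *\<^sub>R x)) \<le> ennreal (1/2) * ennreal (exp_weight \<sigma> \<gamma> k x)"
      using exp_weight_nonneg[of \<sigma> \<gamma> k "2 *\<^sub>R x"] exp_weight_nonneg[of \<sigma> \<gamma> k x] by (simp only: ennreal_mult'')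
    have b: "ennreal (1/2) * ennreal (exp_weight \<sigma> \<gamma> k x) \<le> ennreal (r powr (-\<sigma>))"
    proof -
      have "1/2 * exp_weight \<sigma> \<gamma> k x \<le> r powr (-\<sigma>)"
        using Wle[of x] False exp_weight_nonneg[of \<sigma> \<gamma> k x] by simp
      then have "ennreal (1/2 * exp_weight \<sigma> \<gamma> k x) \<le> ennreal (r powr (-\<sigma>))" by (rule ennreal_leI)
      then show ?thesis using exp_weight_nonneg[of \<sigma> \<gamma> k x] by (simp only: ennreal_mult'')
    qed
    show ?thesis
    proof (cases "norm x \<le> 2 * r")
      case True
      have "ennreal (inverse (1/2) ^ DIM('a)) * ?w (inverse (1/2) *\<^sub>R x) \<le> ennreal (r powr (-\<sigma>))"
        using order_trans[OF a b] by (auto split: split_indicator)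
      then show ?thesis using True by (simp add: add_increasing)
    next
      case F: False
      then show ?thesis using a by (simp split: split_indicator)
    qed
  qed auto
  show "(\<integral>\<^sup>+t. ennreal (inverse t ^ Suc DIM('a)) * ?w (inverse t *\<^sub>R z) * indicator {min 1 (1/2)..max 1 (1/2)} t \<partial>lborel)
    \<le> ennreal (2 ^ Suc DIM('a) / (k * \<gamma>) * (norm z powr (-\<gamma>) * exp_weight \<sigma> \<gamma> k z))"
    (is "_ \<le> ?n") if z: "z \<noteq> 0" for z :: 'a
  proof -
    \<comment> \<open>The decay rate in 1 - t: the tangent of t^(-\<gamma>) at t = 1 bounds the
      exponential at z / t by the one at z times exp (-q (1 - t)).\<close>
    define q where "q = k * \<gamma> * norm z powr \<gamma>"
    have q: "q > 0" using k \<gamma> z by (simp add: q_def)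
    let ?f = "\<lambda>t. 2 ^ Suc DIM('a) * exp_weight \<sigma> \<gamma> k z * exp (- q * (1 - t))"
    let ?F = "\<lambda>t. 2 ^ Suc DIM('a) * exp_weight \<sigma> \<gamma> k z * exp (- q * (1 - t)) / q"
    have "ennreal (inverse t ^ Suc DIM('a)) * ?w (inverse t *\<^sub>R z) * indicator {min 1 (1/2)..max 1 (1/2)} t
        \<le> ennreal (?f t) * indicator {1/2..1} t" for t :: real
    proof (cases "t \<in> {1/2..1}")
      case True
      then have t: "1/2 \<le> t" "t \<le> 1" by auto
      have "1 + \<gamma> * (1 - t) \<le> t powr (-\<gamma>)"
      proof -
        have "exp (- \<gamma> * ln t) \<ge> 1 + (- \<gamma> * ln t)" by (rule exp_ge_add_one_self)
        moreover have "ln t \<le> t - 1" using t by (intro ln_le_minus_one) auto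
        then have "\<gamma> * (1 - t) \<le> \<gamma> * (- ln t)" using \<gamma> by (intro mult_left_mono) auto
        ultimately show ?thesis using t by (simp add: powr_def)
      qed
      then have "k * norm z powr \<gamma> * (1 + \<gamma> * (1 - t)) \<le> k * norm z powr \<gamma> * t powr (-\<gamma>)"
        using k by (intro mult_left_mono) auto
      moreover have "norm (inverse t *\<^sub>R z) powr \<gamma> = norm z powr \<gamma> * t powr (-\<gamma>)"
        using t by (simp add: powr_mult powr_minus powr_divide field_simps)
      ultimately have e: "exp (- k * norm (inverse t *\<^sub>R z) powr \<gamma>) \<le> exp (- k * norm z powr \<gamma>) * exp (- q * (1 - t))"
        by (simp add: exp_add[symmetric] q_def algebra_simps)
      have "norm (inverse t *\<^sub>R z) powr (-\<sigma>) \<le> norm z powr (-\<sigma>)"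
        using t z \<sigma> by (intro powr_mono2') (auto simp: field_simps)
      then have "exp_weight \<sigma> \<gamma> k (inverse t *\<^sub>R z) \<le> norm z powr (-\<sigma>) * (exp (- k * norm z powr \<gamma>) * exp (- q * (1 - t)))"
        unfolding exp_weight_def using e by (intro mult_mono) auto
      moreover have "inverse t ^ Suc DIM('a) \<le> 2 ^ Suc DIM('a)"
        using t le_imp_inverse_le[of "1/2" t] by (intro power_mono) auto
      ultimately have "inverse t ^ Suc DIM('a) * exp_weight \<sigma> \<gamma> k (inverse t *\<^sub>R z)
         \<le> 2 ^ Suc DIM('a) * (norm z powr (-\<sigma>) * (exp (- k * norm z powr \<gamma>) * exp (- q * (1 - t))))"
        using exp_weight_nonneg t by (intro mult_mono) auto
      also have "\<dots> = ?f t" by (simp add: exp_weight_def)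
      finally have le: "inverse t ^ Suc DIM('a) * exp_weight \<sigma> \<gamma> k (inverse t *\<^sub>R z) \<le> ?f t" .
      have "ennreal (inverse t ^ Suc DIM('a)) * ?w (inverse t *\<^sub>R z)
          \<le> ennreal (inverse t ^ Suc DIM('a)) * ennreal (exp_weight \<sigma> \<gamma> k (inverse t *\<^sub>R z))"
        by (intro mult_left_mono) (auto split: split_indicator)
      also have "\<dots> = ennreal (inverse t ^ Suc DIM('a) * exp_weight \<sigma> \<gamma> k (inverse t *\<^sub>R z))"
        using t by (intro ennreal_mult[symmetric] exp_weight_nonneg) auto
      also have "\<dots> \<le> ennreal (?f t)" by (intro ennreal_leI le)
      finally show ?thesis using True by simp
    qed auto
    then have "(\<integral>\<^sup>+t. ennreal (inverse t ^ Suc DIM('a)) * ?w (inverse t *\<^sub>R z) * indicator {min 1 (1/2)..max 1 (1/2)} t \<partial>lborel)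
        \<le> (\<integral>\<^sup>+t. ennreal (?f t) * indicator {1/2..1} t \<partial>lborel)"
      by (intro nn_integral_mono)
    also have "\<dots> = ennreal (?F 1 - ?F (1/2))"
    proof (rule nn_integral_FTC_Icc)
      show "(?F has_real_derivative ?f t) (at t)" for t
        using q by (auto intro!: derivative_eq_intros)
      show "0 \<le> ?f t" for t using exp_weight_nonneg[of \<sigma> \<gamma> k z] by simp
    qed auto
    also have "\<dots> \<le> ?n"
    proof (rule ennreal_leI)
      \<comment> \<open>Only the end point t = 1 matters; there the primitive carries the gain 1 /
        q.\<close>
      have "?F 1 - ?F (1/2) \<le> ?F 1" using q exp_weight_nonneg[of \<sigma> \<gamma> k z] by simp
      also have "\<dots> = 2 ^ Suc DIM('a) / (k * \<gamma>) * (norm z powr (-\<gamma>) * exp_weight \<sigma> \<gamma> k z)"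
        by (simp add: q_def powr_minus field_simps)
      finally show "?F 1 - ?F (1/2) \<le> \<dots>" .
    qed
    finally show ?thesis .
  qed
  have "(\<integral>\<^sup>+x. ennreal (\<Phi> x) * ?w x \<partial>lborel)
      \<le> (\<integral>\<^sup>+x. ennreal (\<Phi> x) * ennreal (exp_weight \<sigma> \<gamma> k x) \<partial>lborel)"
    by (intro nn_integral_mono mult_left_mono) (auto split: split_indicator)
  also have "\<dots> < \<infinity>" by fact
  finally show "(\<integral>\<^sup>+x. ennreal (\<Phi> x) * ?w x \<partial>lborel) < \<infinity>" .
  have [measurable]: "- cball (0::'a) s \<in> sets borel" "cball (0::'a) s \<in> sets borel" for s by simp_all
  show "?w \<in> borel_measurable borel" by measurable
  show "(\<lambda>x. ennreal (r powr (-\<sigma>)) * indicator (cball 0 (2 * r)) x) \<in> borel_measurable (borel :: 'a measure)"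
    by measurable
  show "(\<lambda>x. ennreal (2 ^ Suc DIM('a) / (k * \<gamma>)
      * (norm x powr (-\<gamma>) * exp_weight \<sigma> \<gamma> k x))) \<in> borel_measurable (borel :: 'a measure)"
    by measurable
qed simp_all

text \<open>The estimates near the origin and near infinity leave the annulus r < |x| <= 2r
  uncovered. There the weight is at most r^(-\<sigma>), so the unweighted integral over the ball of
  radius 2r pays for it, and that integral is within reach of the Poincare inequality on a
  ball.\<close>

lemma Hardy_exp_weight:
  fixes \<sigma> \<gamma> k :: real
  assumes \<sigma>: "0 \<le> \<sigma>" "\<sigma> < DIM('a::euclidean_space)" and \<gamma>: "0 < \<gamma>" and k: "0 < k"
  obtains \<rho> C where "0 < \<rho>" "0 < C"
    "\<And>(\<Phi> :: 'a \<Rightarrow> real) \<Psi>. ray_bound \<Phi> \<Psi> \<Longrightarrow>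
      (\<integral>\<^sup>+x. ennreal (\<Phi> x) * ennreal (exp_weight \<sigma> \<gamma> k x) \<partial>lborel) < \<infinity> \<Longrightarrow>
      (\<integral>\<^sup>+x. ennreal (\<Phi> x) * ennreal (exp_weight \<sigma> \<gamma> k x) \<partial>lborel)
      \<le> ennreal C * ((\<integral>\<^sup>+x. ennreal (\<Phi> x) * indicator (cball 0 \<rho>) x \<partial>lborel)
        + (\<integral>\<^sup>+x. ennreal (norm x) * ennreal (\<Psi> x) * ennreal (norm x powr (-\<gamma>) * exp_weight \<sigma> \<gamma> k x) \<partial>lborel))"
proof -
  \<comment> \<open>As the value of r^\<gamma>, this makes the quantity bounded in
    \<open>large\<close> exactly 1/2.\<close>
  define q where "q = (DIM('a) + 1) * ln 2 / (k * (2 powr \<gamma> - 1))"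
  have g1: "2 powr \<gamma> > 1" using \<gamma> powr_less_mono[of 0 \<gamma> 2] by simp
  have q: "q > 0" using g1 k by (simp add: q_def)
  define r where "r = q powr (1 / \<gamma>)"
  have r: "r > 0" using q by (simp add: r_def)
  have "r powr \<gamma> = q" using q \<gamma> by (simp add: r_def powr_powr)
  then have "- k * (2 powr \<gamma> - 1) * r powr \<gamma> = - ((DIM('a) + 1) * ln 2)"
    using g1 k \<gamma> by (simp add: q_def)
  then have "exp (- k * (2 powr \<gamma> - 1) * r powr \<gamma>) = exp (- (real (DIM('a) + 1) * ln 2))" by simp
  also have "\<dots> = 1 / 2 ^ (DIM('a) + 1)"
    by (simp only: exp_minus exp_of_nat_mult exp_ln zero_less_numeral inverse_eq_divide)
  finally have large: "2 ^ DIM('a) * exp (- k * (2 powr \<gamma> - 1) * r powr \<gamma>) \<le> 1 / 2" by simp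
  have "2 powr (\<sigma> - DIM('a)) < 2 powr 0" using \<sigma> by (intro powr_less_mono) auto
  then have \<theta>: "2 powr (\<sigma> - DIM('a)) < 1" by simp
  define C1 where "C1 = 1 / (1 - 2 powr (\<sigma> - DIM('a)))"
  define C2 where "C2 = 2 powr \<sigma> * (2 * r) powr \<gamma> * exp (k * (2 * r) powr \<gamma>)"
  define C3 where "C3 = 2 ^ Suc DIM('a) / (k * \<gamma>)"
  define C4 where "C4 = r powr (-\<sigma>)"
  have pos: "C1 > 0" "C2 > 0" "C3 > 0" "C4 > 0"
    using \<theta> r k \<gamma> by (auto simp: C1_def C2_def C3_def C4_def)
  \<comment> \<open>Sum of all coefficients after adding the three regions; in 3 * C4, two parts
    come from infinity and one from the annulus.\<close>
  define C where "C = C1 * C4 + 3 * C4 + C1 * C2 + 2 * C3"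
  have C: "C > 0" using pos by (simp add: C_def add_pos_pos)
  show ?thesis
  proof (rule that[of "2 * r" C])
    fix \<Phi> \<Psi> :: "'a \<Rightarrow> real"
    assume rb: "ray_bound \<Phi> \<Psi>"
      and fin: "(\<integral>\<^sup>+x. ennreal (\<Phi> x) * ennreal (exp_weight \<sigma> \<gamma> k x) \<partial>lborel) < \<infinity>"
    note [measurable] = borel_measurable_ray_bound[OF rb]
    have [measurable]: "cball (0::'a) s \<in> sets borel" "- cball (0::'a) s \<in> sets borel" for s by simp_all
    define M where "M = (\<integral>\<^sup>+x. ennreal (\<Phi> x) * indicator (cball 0 (2 * r)) x \<partial>lborel)"
    define D where "D = (\<integral>\<^sup>+x. ennreal (norm x) * ennreal (\<Psi> x) * ennreal (norm x powr (-\<gamma>) * exp_weight \<sigma> \<gamma> k x) \<partial>lborel)"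
    have m: "(\<integral>\<^sup>+x. ennreal (\<Phi> x) * (ennreal (r powr (-\<sigma>)) * indicator (cball 0 (2 * r)) x) \<partial>lborel) = ennreal C4 * M"
      unfolding M_def C4_def by (subst nn_integral_cmult[symmetric]) (auto simp: mult_ac)
    have n: "(\<integral>\<^sup>+x. ennreal (norm x) * ennreal (\<Psi> x) * ennreal (c * (norm x powr (-\<gamma>) * exp_weight \<sigma> \<gamma> k x)) \<partial>lborel)
        = ennreal c * D" if "c > 0" for c
      unfolding D_def using that
      by (subst nn_integral_cmult[symmetric]) (auto simp: mult_ac ennreal_mult exp_weight_nonneg)
    let ?near = "\<integral>\<^sup>+x. ennreal (\<Phi> x) * (ennreal (norm x powr (- \<sigma>)) * indicator (cball 0 r) x) \<partial>lborel"
    let ?far = "\<integral>\<^sup>+x. ennreal (\<Phi> x) * (ennreal (exp_weight \<sigma> \<gamma> k x) * indicator (- cball 0 (2 * r)) x) \<partial>lborel"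
    have near: "?near \<le> ennreal C1 * (ennreal C4 * M + ennreal C2 * D)"
      using Hardy_near_origin[OF \<sigma> \<gamma> k r rb fin] unfolding m n[OF pos(2), unfolded C2_def] C1_def C2_def .
    have far: "?far \<le> ennreal 2 * (ennreal C4 * M + ennreal C3 * D)"
      using Hardy_near_infinity[OF \<sigma>(1) \<gamma> k r large rb fin] unfolding m n[OF pos(3), unfolded C3_def] C3_def by simp
    have "(\<integral>\<^sup>+x. ennreal (\<Phi> x) * ennreal (exp_weight \<sigma> \<gamma> k x) \<partial>lborel)
        \<le> (\<integral>\<^sup>+x. ennreal (\<Phi> x) * (ennreal (norm x powr (- \<sigma>)) * indicator (cball 0 r) x)
            + ennreal (\<Phi> x) * (ennreal (exp_weight \<sigma> \<gamma> k x) * indicator (- cball 0 (2 * r)) x)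
            + ennreal (\<Phi> x) * (ennreal C4 * indicator (cball 0 (2 * r)) x) \<partial>lborel)"
    proof (rule nn_integral_mono)
      fix x :: 'a
      have W: "exp_weight \<sigma> \<gamma> k x \<le> norm x powr (-\<sigma>)"
        unfolding exp_weight_def using k mult_left_mono[of "exp (- k * norm x powr \<gamma>)" 1 "norm x powr (-\<sigma>)"] by simp
      have "ennreal (exp_weight \<sigma> \<gamma> k x) \<le> ennreal (norm x powr (- \<sigma>)) * indicator (cball 0 r) x
          + ennreal (exp_weight \<sigma> \<gamma> k x) * indicator (- cball 0 (2 * r)) x + ennreal C4 * indicator (cball 0 (2 * r)) x"
      proof -
        consider "norm x \<le> r" | "r < norm x" "norm x \<le> 2 * r" | "2 * r < norm x" by linarith
        then show ?thesis
        proof cases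
          case 1
          have "ennreal (exp_weight \<sigma> \<gamma> k x) \<le> ennreal (norm x powr (- \<sigma>)) * indicator (cball 0 r) x"
            using 1 W by (simp add: ennreal_leI)
          then show ?thesis by (simp add: add_increasing2)
        next
          case 2
          have "norm x powr (-\<sigma>) \<le> C4" unfolding C4_def using 2 r \<sigma> by (intro powr_mono2') auto
          then have "ennreal (exp_weight \<sigma> \<gamma> k x) \<le> ennreal C4 * indicator (cball 0 (2 * r)) x"
            using 2 W by (simp add: ennreal_leI)
          then show ?thesis by (simp add: add_increasing)
        next
          case 3
          have "ennreal (exp_weight \<sigma> \<gamma> k x) \<le> ennreal (exp_weight \<sigma> \<gamma> k x) * indicator (- cball 0 (2 * r)) x"
            using 3 by simp
          then show ?thesis by (simp add: add_increasing add_increasing2)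
        qed
      qed
      from mult_left_mono[OF this, of "ennreal (\<Phi> x)"]
      show "ennreal (\<Phi> x) * ennreal (exp_weight \<sigma> \<gamma> k x)
        \<le> ennreal (\<Phi> x) * (ennreal (norm x powr (- \<sigma>)) * indicator (cball 0 r) x)
            + ennreal (\<Phi> x) * (ennreal (exp_weight \<sigma> \<gamma> k x) * indicator (- cball 0 (2 * r)) x)
            + ennreal (\<Phi> x) * (ennreal C4 * indicator (cball 0 (2 * r)) x)"
        by (simp only: distrib_left zero_le)
    qed
    also have "\<dots> = ?near + ?far + ennreal C4 * M"
      using m by (simp add: nn_integral_add C4_def)
    also have "\<dots> \<le> ennreal C1 * (ennreal C4 * M + ennreal C2 * D) + ennreal 2 * (ennreal C4 * M + ennreal C3 * D) + ennreal C4 * M"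
      by (intro add_mono near far order_refl)
    also have "\<dots> = ennreal (C1 * C4 + 3 * C4) * M + ennreal (C1 * C2 + 2 * C3) * D"
    proof -
      have "C1 * C4 + 3 * C4 = C1 * C4 + 2 * C4 + C4" by simp
      then have "ennreal (C1 * C4 + 3 * C4) = ennreal C1 * ennreal C4 + ennreal 2 * ennreal C4 + ennreal C4"
        using pos by (simp only: ennreal_plus ennreal_mult'' less_imp_le mult_nonneg_nonneg add_nonneg_nonneg zero_le_numeral)
      moreover have "ennreal (C1 * C2 + 2 * C3) = ennreal C1 * ennreal C2 + ennreal 2 * ennreal C3"
        using pos by (simp only: ennreal_plus ennreal_mult'' less_imp_le mult_nonneg_nonneg zero_le_numeral)
      ultimately show ?thesis by (simp only: distrib_left distrib_right add_ac mult_ac)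
    qed
    also have "\<dots> \<le> ennreal C * M + ennreal C * D"
      using pos by (intro add_mono mult_right_mono ennreal_leI) (auto simp: C_def)
    finally show "(\<integral>\<^sup>+x. ennreal (\<Phi> x) * ennreal (exp_weight \<sigma> \<gamma> k x) \<partial>lborel)
      \<le> ennreal C * ((\<integral>\<^sup>+x. ennreal (\<Phi> x) * indicator (cball 0 (2 * r)) x \<partial>lborel)
        + (\<integral>\<^sup>+x. ennreal (norm x) * ennreal (\<Psi> x) * ennreal (norm x powr (-\<gamma>) * exp_weight \<sigma> \<gamma> k x) \<partial>lborel))"
      by (simp only: distrib_left M_def D_def)
  qed (use r C in auto)
qed

subsection \<open>Weighted Poincare inequality\<close>

text \<open>The constant c is the one from the ball of radius \<rho>, and the Hardy inequality for
  |f - c|^p spreads the estimate to the whole space. For \<sigma> = pa and \<tau> = pb the relation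
  between them is just the definition of \<gamma>. Finiteness stays a premise because it is used
  twice, inside the Hardy inequality and to absorb the Young term.\<close>

lemma Poincare_exp_weight:
  fixes p \<sigma> \<tau> \<gamma> k :: real
  assumes p: "1 < p" and \<sigma>: "0 \<le> \<sigma>" "\<sigma> < DIM('a::euclidean_space)" and \<gamma>: "0 < \<gamma>" and k: "0 < k"
    and \<tau>: "0 \<le> \<tau>" "\<sigma> = \<tau> + p * (1 - \<gamma>)"
  obtains C where "0 < C"
    "\<And>(f :: 'a \<Rightarrow> real) G. (\<And>x. (f has_derivative (\<lambda>h. G x \<bullet> h)) (at x)) \<Longrightarrow> continuous_on UNIV G \<Longrightarrow>
      \<exists>c. (\<integral>\<^sup>+x. ennreal (\<bar>f x - c\<bar> powr p) * ennreal (exp_weight \<sigma> \<gamma> k x) \<partial>lborel) < \<infinity> \<longrightarrow>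
        (\<integral>\<^sup>+x. ennreal (\<bar>f x - c\<bar> powr p) * ennreal (exp_weight \<sigma> \<gamma> k x) \<partial>lborel)
        \<le> ennreal C * (\<integral>\<^sup>+x. ennreal (norm (G x) powr p) * ennreal (exp_weight \<tau> \<gamma> k x) \<partial>lborel)"
proof -
  obtain \<rho> A where \<rho>: "0 < \<rho>" and A: "0 < A"
    and Hardy: "\<And>(\<Phi> :: 'a \<Rightarrow> real) \<Psi>. ray_bound \<Phi> \<Psi> \<Longrightarrow>
      (\<integral>\<^sup>+x. ennreal (\<Phi> x) * ennreal (exp_weight \<sigma> \<gamma> k x) \<partial>lborel) < \<infinity> \<Longrightarrow>
      (\<integral>\<^sup>+x. ennreal (\<Phi> x) * ennreal (exp_weight \<sigma> \<gamma> k x) \<partial>lborel)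
      \<le> ennreal A * ((\<integral>\<^sup>+x. ennreal (\<Phi> x) * indicator (cball 0 \<rho>) x \<partial>lborel)
        + (\<integral>\<^sup>+x. ennreal (norm x) * ennreal (\<Psi> x) * ennreal (norm x powr (-\<gamma>) * exp_weight \<sigma> \<gamma> k x) \<partial>lborel))"
    using Hardy_exp_weight[OF \<sigma> \<gamma> k] by blast
  \<comment> \<open>The last factor is the reciprocal of the smallest value of the weight with
    exponent \<tau> on the punctured ball, attained at |x| = \<rho>.\<close>
  define B where "B = 2 ^ DIM('a) * (2 * \<rho>) powr p * (\<rho> powr \<tau> * exp (k * \<rho> powr \<gamma>))"
  \<comment> \<open>Makes the Young term A p \<epsilon> X equal to X / 2.\<close>
  define \<epsilon> where "\<epsilon> = 1 / (2 * A * p)"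
  have \<epsilon>: "\<epsilon> > 0" using A p by (simp add: \<epsilon>_def)
  define E where "E = p * \<epsilon> powr (1 - p)"
  define C where "C = 2 * A * (B + E)"
  have BE: "B > 0" "E > 0" using \<rho> p \<epsilon> by (auto simp: B_def E_def)
  have nz: "AE x in lborel. x \<noteq> (0::'a)" by (rule AE_lborel_singleton)
  show ?thesis
  proof (rule that[of C])
    show "0 < C" using A BE by (simp add: C_def)
    fix f :: "'a \<Rightarrow> real" and G
    assume der: "\<And>x. (f has_derivative (\<lambda>h. G x \<bullet> h)) (at x)" and cont: "continuous_on UNIV G"
    have cf: "continuous_on UNIV f" using der
      by (meson continuous_at_imp_continuous_on has_derivative_continuous)
    note [measurable] = borel_measurable_continuous_onI[OF cf] borel_measurable_continuous_onI[OF cont]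
    define Y where "Y = (\<integral>\<^sup>+x. ennreal (norm (G x) powr p) * ennreal (exp_weight \<tau> \<gamma> k x) \<partial>lborel)"
    have "1 \<le> p" using p by simp
    from Poincare_cball[OF this \<rho> der cont]
    obtain c where c: "(\<integral>\<^sup>+x. ennreal (\<bar>f x - c\<bar> powr p) * indicator (cball 0 \<rho>) x \<partial>lborel)
      \<le> ennreal (2 ^ DIM('a) * (2 * \<rho>) powr p) * (\<integral>\<^sup>+x. ennreal (norm (G x) powr p) * indicator (cball 0 \<rho>) x \<partial>lborel)"
      by blast
    define X where "X = (\<integral>\<^sup>+x. ennreal (\<bar>f x - c\<bar> powr p) * ennreal (exp_weight \<sigma> \<gamma> k x) \<partial>lborel)"
    have "X \<le> ennreal C * Y" if fin: "X < \<infinity>"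
    proof -
      have "(\<integral>\<^sup>+x. ennreal (norm (G x) powr p) * indicator (cball 0 \<rho>) x \<partial>lborel)
          \<le> (\<integral>\<^sup>+x. ennreal (\<rho> powr \<tau> * exp (k * \<rho> powr \<gamma>)) * (ennreal (norm (G x) powr p) * ennreal (exp_weight \<tau> \<gamma> k x)) \<partial>lborel)"
      \<comment> \<open>The origin has to be excluded: there \<open>powr\<close> makes the weight 0,
        so the pointwise bound may fail.\<close>
      proof (rule nn_integral_mono_AE, use nz in eventually_elim)
        fix x :: 'a assume x: "x \<noteq> 0"
        show "ennreal (norm (G x) powr p) * indicator (cball 0 \<rho>) x
            \<le> ennreal (\<rho> powr \<tau> * exp (k * \<rho> powr \<gamma>)) * (ennreal (norm (G x) powr p) * ennreal (exp_weight \<tau> \<gamma> k x))"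
        proof (cases "norm x \<le> \<rho>")
          case True
          have "1 = norm x powr \<tau> * exp (k * norm x powr \<gamma>) * exp_weight \<tau> \<gamma> k x"
            using x by (simp add: exp_weight_def exp_minus powr_minus field_simps)
          also have "\<dots> \<le> \<rho> powr \<tau> * exp (k * \<rho> powr \<gamma>) * exp_weight \<tau> \<gamma> k x"
          proof (intro mult_right_mono mult_mono exp_weight_nonneg)
            show "norm x powr \<tau> \<le> \<rho> powr \<tau>" using True \<tau> by (intro powr_mono2) auto
            have "norm x powr \<gamma> \<le> \<rho> powr \<gamma>" using True \<gamma> by (intro powr_mono2) auto
            then show "exp (k * norm x powr \<gamma>) \<le> exp (k * \<rho> powr \<gamma>)" using k by simp
          qed auto
          finally have "norm (G x) powr p * 1 \<le> norm (G x) powr p * (\<rho> powr \<tau> * exp (k * \<rho> powr \<gamma>) * exp_weight \<tau> \<gamma> k x)"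
            by (intro mult_left_mono) auto
          then have "ennreal (norm (G x) powr p) \<le> ennreal (\<rho> powr \<tau> * exp (k * \<rho> powr \<gamma>) * (norm (G x) powr p * exp_weight \<tau> \<gamma> k x))"
            by (intro ennreal_leI) (simp add: mult_ac)
          then show ?thesis using True exp_weight_nonneg[of \<tau> \<gamma> k x] by (simp add: ennreal_mult)
        qed simp
      qed
      also have "\<dots> = ennreal (\<rho> powr \<tau> * exp (k * \<rho> powr \<gamma>)) * Y"
        unfolding Y_def by (rule nn_integral_cmult) simp
      finally have "ennreal (2 ^ DIM('a) * (2 * \<rho>) powr p) * (\<integral>\<^sup>+x. ennreal (norm (G x) powr p) * indicator (cball 0 \<rho>) x \<partial>lborel)
          \<le> ennreal (2 ^ DIM('a) * (2 * \<rho>) powr p) * (ennreal (\<rho> powr \<tau> * exp (k * \<rho> powr \<gamma>)) * Y)"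
        by (intro mult_left_mono) auto
      also have "\<dots> = ennreal B * Y"
        by (simp add: B_def ennreal_mult mult.assoc)
      finally have M: "(\<integral>\<^sup>+x. ennreal (\<bar>f x - c\<bar> powr p) * indicator (cball 0 \<rho>) x \<partial>lborel) \<le> ennreal B * Y"
        using c by (rule order_trans[rotated])
      have D: "(\<integral>\<^sup>+x. ennreal (norm x) * ennreal (p * \<bar>f x - c\<bar> powr (p - 1) * norm (G x)) * ennreal (norm x powr (-\<gamma>) * exp_weight \<sigma> \<gamma> k x) \<partial>lborel)
          \<le> ennreal (p * \<epsilon>) * X + ennreal E * Y" (is "?D \<le> _")
      proof -
        have "?D \<le> (\<integral>\<^sup>+x. ennreal (p * \<epsilon>) * (ennreal (\<bar>f x - c\<bar> powr p) * ennreal (exp_weight \<sigma> \<gamma> k x))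
            + ennreal E * (ennreal (norm (G x) powr p) * ennreal (exp_weight \<tau> \<gamma> k x)) \<partial>lborel)"
        proof (rule nn_integral_mono)
          fix x :: 'a
          let ?W = "exp_weight \<sigma> \<gamma> k x" and ?g = "\<bar>f x - c\<bar>"
          have real: "norm x * (p * ?g powr (p - 1) * norm (G x)) * (norm x powr (-\<gamma>) * ?W)
            \<le> p * \<epsilon> * (?g powr p * ?W) + E * (norm (G x) powr p * exp_weight \<tau> \<gamma> k x)"
          proof (cases "x = 0")
            case True
            then show ?thesis using p \<epsilon> BE exp_weight_nonneg[of \<sigma> \<gamma> k x] exp_weight_nonneg[of \<tau> \<gamma> k x] by simp
          next
            case False
            \<comment> \<open>Young's inequality raises |x|^(1-\<gamma>) to the power p, which is
              exactly the quotient of the two weights.\<close>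
            have e: "norm x powr (p * (1 - \<gamma>)) * ?W = exp_weight \<tau> \<gamma> k x"
              using False by (simp add: exp_weight_def \<tau>(2) powr_add[symmetric])
            have "norm x * (p * ?g powr (p - 1) * norm (G x)) * (norm x powr (-\<gamma>) * ?W)
                = p * (?g powr (p - 1) * (norm (G x) * norm x powr (1 - \<gamma>))) * ?W"
              using False by (simp add: powr_diff powr_minus field_simps)
            also have "\<dots> \<le> p * (\<epsilon> * ?g powr p + \<epsilon> powr (1 - p) * (norm (G x) * norm x powr (1 - \<gamma>)) powr p) * ?W"
              using p \<epsilon> exp_weight_nonneg[of \<sigma> \<gamma> k x]
              by (intro mult_right_mono mult_left_mono powr_Young) auto
            also have "\<dots> = p * \<epsilon> * (?g powr p * ?W) + E * (norm (G x) powr p * (norm x powr (p * (1 - \<gamma>)) * ?W))"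
              by (simp add: powr_mult powr_powr E_def algebra_simps)
            finally show ?thesis unfolding e .
          qed
          have "ennreal (norm x * (p * ?g powr (p - 1) * norm (G x)) * (norm x powr (-\<gamma>) * ?W))
            \<le> ennreal (p * \<epsilon> * (?g powr p * ?W) + E * (norm (G x) powr p * exp_weight \<tau> \<gamma> k x))"
            by (rule ennreal_leI[OF real])
          then show "ennreal (norm x) * ennreal (p * ?g powr (p - 1) * norm (G x)) * ennreal (norm x powr (-\<gamma>) * ?W)
            \<le> ennreal (p * \<epsilon>) * (ennreal (?g powr p) * ennreal ?W) + ennreal E * (ennreal (norm (G x) powr p) * ennreal (exp_weight \<tau> \<gamma> k x))"
            using p \<epsilon> BE exp_weight_nonneg[of \<sigma> \<gamma> k x] exp_weight_nonneg[of \<tau> \<gamma> k x]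
            by (simp add: ennreal_mult)
        qed
        also have "\<dots> = ennreal (p * \<epsilon>) * X + ennreal E * Y"
          unfolding X_def Y_def by (subst nn_integral_add) (auto simp: nn_integral_cmult)
        finally show ?thesis .
      qed
      have "X \<le> ennreal A * ((\<integral>\<^sup>+x. ennreal (\<bar>f x - c\<bar> powr p) * indicator (cball 0 \<rho>) x \<partial>lborel) + ?D)"
        unfolding X_def by (rule Hardy[OF ray_bound_abs_powr[OF p der cont] fin[unfolded X_def]])
      also have "\<dots> \<le> ennreal A * (ennreal B * Y + (ennreal (p * \<epsilon>) * X + ennreal E * Y))"
        by (intro mult_left_mono add_mono M D) auto
      also have "\<dots> = ennreal (1/2) * X + ennreal (A * (B + E)) * Y"
      proof -
        have "ennreal (1/2) = ennreal A * ennreal (p * \<epsilon>)"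
          using A p by (simp add: ennreal_mult'[symmetric] \<epsilon>_def)
        moreover have "ennreal (A * (B + E)) = ennreal A * ennreal B + ennreal A * ennreal E"
          using A BE by (simp add: ennreal_mult'[symmetric] ennreal_plus[symmetric] distrib_left del: ennreal_plus)
        ultimately show ?thesis by (simp only: distrib_left distrib_right add_ac mult_ac)
      qed
      finally have "X \<le> ennreal (1 / (1 - 1/2)) * (ennreal (A * (B + E)) * Y)"
        using fin by (intro ennreal_absorb) auto
      also have "\<dots> = ennreal C * Y"
        using A BE by (simp add: C_def mult.assoc ennreal_mult)
      finally show ?thesis .
    qed
    then show "\<exists>c. (\<integral>\<^sup>+x. ennreal (\<bar>f x - c\<bar> powr p) * ennreal (exp_weight \<sigma> \<gamma> k x) \<partial>lborel) < \<infinity> \<longrightarrow>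
        (\<integral>\<^sup>+x. ennreal (\<bar>f x - c\<bar> powr p) * ennreal (exp_weight \<sigma> \<gamma> k x) \<partial>lborel)
        \<le> ennreal C * (\<integral>\<^sup>+x. ennreal (norm (G x) powr p) * ennreal (exp_weight \<tau> \<gamma> k x) \<partial>lborel)"
      unfolding X_def Y_def by blast
  qed
qed

text \<open>Dilation by l with l^\<gamma> = 1 / \<mu> turns the rate \<mu> k into k, so one constant
  serves all \<mu>. The powers of l from Jacobians, weights and gradient combine to l^(p + \<tau> -
  \<sigma>) = l^(p \<gamma>) = \<mu>^(-p).\<close>

lemma Poincare_exp_weight_scaled:
  fixes p \<sigma> \<tau> \<gamma> k :: real
  assumes p: "1 < p" and \<sigma>: "0 \<le> \<sigma>" "\<sigma> < DIM('a::euclidean_space)" and \<gamma>: "0 < \<gamma>" and k: "0 < k"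
    and \<tau>: "0 \<le> \<tau>" "\<sigma> = \<tau> + p * (1 - \<gamma>)"
  obtains C where "0 < C"
    "\<And>(f :: 'a \<Rightarrow> real) G \<mu>. 0 < \<mu> \<Longrightarrow> (\<And>x. (f has_derivative (\<lambda>h. G x \<bullet> h)) (at x)) \<Longrightarrow> continuous_on UNIV G \<Longrightarrow>
      \<exists>c. (\<integral>\<^sup>+x. ennreal (\<bar>f x - c\<bar> powr p) * ennreal (exp_weight \<sigma> \<gamma> (\<mu> * k) x) \<partial>lborel) < \<infinity> \<longrightarrow>
        (\<integral>\<^sup>+x. ennreal (\<bar>f x - c\<bar> powr p) * ennreal (exp_weight \<sigma> \<gamma> (\<mu> * k) x) \<partial>lborel)
        \<le> ennreal (C * \<mu> powr (-p)) * (\<integral>\<^sup>+x. ennreal (norm (G x) powr p) * ennreal (exp_weight \<tau> \<gamma> (\<mu> * k) x) \<partial>lborel)"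
proof -
  obtain C where C: "0 < C" and Poincare: "\<And>(f :: 'a \<Rightarrow> real) G. (\<And>x. (f has_derivative (\<lambda>h. G x \<bullet> h)) (at x)) \<Longrightarrow> continuous_on UNIV G \<Longrightarrow>
      \<exists>c. (\<integral>\<^sup>+x. ennreal (\<bar>f x - c\<bar> powr p) * ennreal (exp_weight \<sigma> \<gamma> k x) \<partial>lborel) < \<infinity> \<longrightarrow>
        (\<integral>\<^sup>+x. ennreal (\<bar>f x - c\<bar> powr p) * ennreal (exp_weight \<sigma> \<gamma> k x) \<partial>lborel)
        \<le> ennreal C * (\<integral>\<^sup>+x. ennreal (norm (G x) powr p) * ennreal (exp_weight \<tau> \<gamma> k x) \<partial>lborel)"
    using Poincare_exp_weight[OF p \<sigma> \<gamma> k \<tau>] by blast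
  show ?thesis
  proof (rule that[OF C])
    fix f :: "'a \<Rightarrow> real" and G and \<mu> :: real
    assume \<mu>: "0 < \<mu>" and der: "\<And>x. (f has_derivative (\<lambda>h. G x \<bullet> h)) (at x)" and cont: "continuous_on UNIV G"
    have cf: "continuous_on UNIV f" using der
      by (meson continuous_at_imp_continuous_on has_derivative_continuous)
    note [measurable] = borel_measurable_continuous_onI[OF cf] borel_measurable_continuous_onI[OF cont]
    define l where "l = \<mu> powr (- 1 / \<gamma>)"
    have l: "l > 0" using \<mu> by (simp add: l_def)
    have l\<gamma>: "l powr \<gamma> = 1 / \<mu>"
      using \<mu> \<gamma> unfolding l_def powr_powr by (simp add: powr_minus_divide)
    have lp: "l powr (p * \<gamma>) = \<mu> powr (-p)"
      using \<gamma> unfolding l_def powr_powr by (simp add: mult.commute)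
    have ew: "exp_weight \<zeta> \<gamma> k x = l powr \<zeta> * exp_weight \<zeta> \<gamma> (\<mu> * k) (l *\<^sub>R x)" for \<zeta> and x :: 'a
      using l \<mu> by (simp add: exp_weight_def powr_mult l\<gamma> powr_minus)
    have scale: "(\<integral>\<^sup>+x. ennreal (h (l *\<^sub>R x)) * ennreal (exp_weight \<zeta> \<gamma> k x) \<partial>lborel)
        = ennreal (l powr (\<zeta> - DIM('a))) * (\<integral>\<^sup>+x. ennreal (h x) * ennreal (exp_weight \<zeta> \<gamma> (\<mu> * k) x) \<partial>lborel)"
      if [measurable]: "h \<in> borel_measurable borel" for h :: "'a \<Rightarrow> real" and \<zeta>
    proof -
      let ?g = "\<lambda>x. ennreal (h x) * ennreal (exp_weight \<zeta> \<gamma> (\<mu> * k) x)"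
      have "(\<integral>\<^sup>+x. ennreal (h (l *\<^sub>R x)) * ennreal (exp_weight \<zeta> \<gamma> k x) \<partial>lborel)
          = (\<integral>\<^sup>+x. ennreal (l powr \<zeta>) * ?g (0 + l *\<^sub>R x) \<partial>lborel)"
        unfolding ew by (intro nn_integral_cong) (simp add: ennreal_mult exp_weight_nonneg mult_ac)
      also have "\<dots> = ennreal (l powr \<zeta>) * (\<integral>\<^sup>+x. ?g (0 + l *\<^sub>R x) \<partial>lborel)"
        by (rule nn_integral_cmult) simp
      also have "\<dots> = ennreal (l powr \<zeta>) * (ennreal (inverse l ^ DIM('a)) * (\<integral>\<^sup>+x. ?g x \<partial>lborel))"
        using l by (subst nn_integral_lborel_affine) auto
      also have "ennreal (l powr \<zeta>) * (ennreal (inverse l ^ DIM('a)) * (\<integral>\<^sup>+x. ?g x \<partial>lborel))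
          = ennreal (l powr (\<zeta> - DIM('a))) * (\<integral>\<^sup>+x. ?g x \<partial>lborel)"
      proof -
        have "l powr \<zeta> * inverse l ^ DIM('a) = l powr (\<zeta> - DIM('a))"
          using l by (simp add: powr_diff powr_realpow power_inverse divide_inverse)
        then show ?thesis using l by (simp add: mult.assoc[symmetric] ennreal_mult'[symmetric])
      qed
      finally show ?thesis .
    qed
    have der': "((\<lambda>x. f (l *\<^sub>R x)) has_derivative (\<lambda>h. (l *\<^sub>R G (l *\<^sub>R x)) \<bullet> h)) (at x)" for x
    proof -
      have "((\<lambda>x. l *\<^sub>R x) has_derivative (\<lambda>h. l *\<^sub>R h)) (at x)" by (auto intro!: derivative_eq_intros)
      from has_derivative_compose[OF this der] show ?thesis by simp
    qed
    have cont': "continuous_on UNIV (\<lambda>x. l *\<^sub>R G (l *\<^sub>R x))"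
      by (intro continuous_intros continuous_on_compose2[OF cont]) auto
    obtain c where c: "(\<integral>\<^sup>+x. ennreal (\<bar>f (l *\<^sub>R x) - c\<bar> powr p) * ennreal (exp_weight \<sigma> \<gamma> k x) \<partial>lborel) < \<infinity> \<longrightarrow>
        (\<integral>\<^sup>+x. ennreal (\<bar>f (l *\<^sub>R x) - c\<bar> powr p) * ennreal (exp_weight \<sigma> \<gamma> k x) \<partial>lborel)
        \<le> ennreal C * (\<integral>\<^sup>+x. ennreal (norm (l *\<^sub>R G (l *\<^sub>R x)) powr p) * ennreal (exp_weight \<tau> \<gamma> k x) \<partial>lborel)"
      using Poincare[OF der' cont'] by blast
    define X where "X = (\<integral>\<^sup>+x. ennreal (\<bar>f x - c\<bar> powr p) * ennreal (exp_weight \<sigma> \<gamma> (\<mu> * k) x) \<partial>lborel)"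
    define Y where "Y = (\<integral>\<^sup>+x. ennreal (norm (G x) powr p) * ennreal (exp_weight \<tau> \<gamma> (\<mu> * k) x) \<partial>lborel)"
    have lhs: "(\<integral>\<^sup>+x. ennreal (\<bar>f (l *\<^sub>R x) - c\<bar> powr p) * ennreal (exp_weight \<sigma> \<gamma> k x) \<partial>lborel)
        = ennreal (l powr (\<sigma> - DIM('a))) * X"
      unfolding X_def by (rule scale) simp
    have "(\<integral>\<^sup>+x. ennreal (norm (l *\<^sub>R G (l *\<^sub>R x)) powr p) * ennreal (exp_weight \<tau> \<gamma> k x) \<partial>lborel)
        = (\<integral>\<^sup>+x. ennreal (l powr p) * (ennreal (norm (G (l *\<^sub>R x)) powr p) * ennreal (exp_weight \<tau> \<gamma> k x)) \<partial>lborel)"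
      using l by (intro nn_integral_cong) (simp add: powr_mult ennreal_mult mult.assoc)
    also have "\<dots> = ennreal (l powr p) * (\<integral>\<^sup>+x. ennreal (norm (G (l *\<^sub>R x)) powr p) * ennreal (exp_weight \<tau> \<gamma> k x) \<partial>lborel)"
      by (rule nn_integral_cmult) simp
    also have "(\<integral>\<^sup>+x. ennreal (norm (G (l *\<^sub>R x)) powr p) * ennreal (exp_weight \<tau> \<gamma> k x) \<partial>lborel)
        = ennreal (l powr (\<tau> - DIM('a))) * Y"
      unfolding Y_def by (rule scale) simp
    finally have rhs: "(\<integral>\<^sup>+x. ennreal (norm (l *\<^sub>R G (l *\<^sub>R x)) powr p) * ennreal (exp_weight \<tau> \<gamma> k x) \<partial>lborel)
        = ennreal (l powr p) * (ennreal (l powr (\<tau> - DIM('a))) * Y)" .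
    have "X \<le> ennreal (C * \<mu> powr (-p)) * Y" if fin: "X < \<infinity>"
    proof -
      have "ennreal (l powr (\<sigma> - DIM('a))) * X \<le> ennreal C * (ennreal (l powr p) * (ennreal (l powr (\<tau> - DIM('a))) * Y))"
        using c fin unfolding lhs rhs by (simp add: ennreal_mult_less_top)
      \<comment> \<open>Multiplying by the inverse power isolates X without dividing in
        \<open>ennreal\<close>.\<close>
      then have "ennreal (l powr (DIM('a) - \<sigma>)) * (ennreal (l powr (\<sigma> - DIM('a))) * X)
         \<le> ennreal (l powr (DIM('a) - \<sigma>)) * (ennreal C * (ennreal (l powr p) * (ennreal (l powr (\<tau> - DIM('a))) * Y)))"
        by (intro mult_left_mono) auto
      also have "ennreal (l powr (DIM('a) - \<sigma>)) * (ennreal (l powr (\<sigma> - DIM('a))) * X) = X"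
        using l by (simp add: mult.assoc[symmetric] ennreal_mult'[symmetric] powr_add[symmetric])
      also have "ennreal (l powr (DIM('a) - \<sigma>)) * (ennreal C * (ennreal (l powr p) * (ennreal (l powr (\<tau> - DIM('a))) * Y)))
          = ennreal (l powr (DIM('a) - \<sigma>) * (C * (l powr p * l powr (\<tau> - DIM('a))))) * Y"
        using C by (simp add: ennreal_mult mult.assoc)
      also have "l powr (DIM('a) - \<sigma>) * (C * (l powr p * l powr (\<tau> - DIM('a)))) = C * l powr (p * \<gamma>)"
      proof -
        have "l powr (DIM('a) - \<sigma>) * (l powr p * l powr (\<tau> - DIM('a))) = l powr (p * \<gamma>)"
          unfolding powr_add[symmetric] by (rule arg_cong[where f = "(powr) l"]) (simp add: \<tau>(2) algebra_simps)
        then show ?thesis by (simp add: mult_ac)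
      qed
      finally show ?thesis unfolding lp .
    qed
    then show "\<exists>c. (\<integral>\<^sup>+x. ennreal (\<bar>f x - c\<bar> powr p) * ennreal (exp_weight \<sigma> \<gamma> (\<mu> * k) x) \<partial>lborel) < \<infinity> \<longrightarrow>
        (\<integral>\<^sup>+x. ennreal (\<bar>f x - c\<bar> powr p) * ennreal (exp_weight \<sigma> \<gamma> (\<mu> * k) x) \<partial>lborel)
        \<le> ennreal (C * \<mu> powr (-p)) * (\<integral>\<^sup>+x. ennreal (norm (G x) powr p) * ennreal (exp_weight \<tau> \<gamma> (\<mu> * k) x) \<partial>lborel)"
      unfolding X_def Y_def by blast
  qed
qed

subsection \<open>The deficit\<close>

text \<open>On a closed annulus around the origin the power of the norm is continuous, so every real
  exponent e is allowed.\<close>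

lemma integrable_annulus_powr:
  fixes g :: "'a::euclidean_space \<Rightarrow> real" and r R e :: real
  assumes cont: "continuous_on UNIV g" and r: "0 < r"
    and supp: "\<And>x. norm x < r \<or> R < norm x \<Longrightarrow> g x = 0"
  shows "integrable lborel (\<lambda>x. g x * norm x powr e)"
proof -
  let ?A = "cball (0::'a) R - ball 0 r"
  have "integrable lborel (\<lambda>x. indicator ?A x *\<^sub>R (g x * norm x powr e))"
  proof (rule borel_integrable_compact)
    show "compact ?A" by (intro compact_diff) auto
    show "continuous_on ?A (\<lambda>x. g x * norm x powr e)"
      using r by (intro continuous_intros continuous_on_subset[OF cont]) auto
  qed
  moreover have "indicator ?A x *\<^sub>R (g x * norm x powr e) = g x * norm x powr e" for x
  proof (cases "x \<in> ?A")
    case False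
    then have "norm x < r \<or> R < norm x" by auto
    then show ?thesis using supp by simp
  qed simp
  ultimately show ?thesis by (simp only:)
qed

text \<open>Differentiating \<open>\<integral> |u(tx)|\<^sup>p |x|\<^bsup>-s\<^esup> dx = t\<^bsup>s-N\<^esup> \<integral> |u|\<^sup>p |x|\<^bsup>-s\<^esup> dx\<close> at \<open>t = 1\<close> replaces the divergence
  theorem for the field \<open>|x|\<^bsup>-s\<^esup> x\<close>.\<close>

lemma integral_radial_derivative:
  fixes u :: "'a::euclidean_space \<Rightarrow> real" and G :: "'a \<Rightarrow> 'a" and p r R s :: real
  assumes p: "1 < p" and r: "0 < r"
    and der: "\<And>x. (u has_derivative (\<lambda>h. G x \<bullet> h)) (at x)" and cont: "continuous_on UNIV G"
    and supp: "\<And>x. norm x < r \<or> R < norm x \<Longrightarrow> u x = 0"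
    and suppG: "\<And>x. norm x < r \<or> R < norm x \<Longrightarrow> G x = 0"
  shows "(\<integral>x. p * (\<bar>u x\<bar> powr (p - 1) * sgn (u x) * (G x \<bullet> x)) * norm x powr (-s) \<partial>lborel)
    = (s - DIM('a)) * (\<integral>x. \<bar>u x\<bar> powr p * norm x powr (-s) \<partial>lborel)"
proof -
  have cu: "continuous_on UNIV u" using der
    by (meson continuous_at_imp_continuous_on has_derivative_continuous)
  note [measurable] = borel_measurable_continuous_onI[OF cu] borel_measurable_continuous_onI[OF cont]
  define \<Phi> where "\<Phi> x = \<bar>u x\<bar> powr p" for x
  define H where "H x = p * (\<bar>u x\<bar> powr (p - 1) * sgn (u x) * (G x \<bullet> x))" for x
  define I where "I = (\<integral>x. \<Phi> x * norm x powr (-s) \<partial>lborel)"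
  have c\<Phi>: "continuous_on UNIV \<Phi>" unfolding \<Phi>_def using p
    by (intro continuous_intros cu continuous_on_powr') auto
  have cH: "continuous_on UNIV H" unfolding H_def using p
    by (intro continuous_intros cont continuous_on_compose2[OF continuous_on_sgn_powr cu]) auto
  note [measurable] = borel_measurable_continuous_onI[OF c\<Phi>] borel_measurable_continuous_onI[OF cH]
  have \<Phi>0: "norm x < r \<or> R < norm x \<Longrightarrow> \<Phi> x = 0" for x using supp by (simp add: \<Phi>_def)
  have ray: "((\<lambda>t. \<Phi> (t *\<^sub>R x)) has_real_derivative H (t *\<^sub>R x) / t) (at t)" if "t \<noteq> 0" for t x
  proof -
    have "((\<lambda>t. u (t *\<^sub>R x)) has_real_derivative G (t *\<^sub>R x) \<bullet> x) (at t)"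
      using has_real_derivative_along_line[OF der, of 0 x t] by simp
    from DERIV_chain2[OF has_real_derivative_abs_powr[OF p] this]
    show ?thesis using that by (simp add: \<Phi>_def H_def mult_ac)
  qed
  obtain K where K: "\<And>x. \<bar>H x\<bar> \<le> K" "K \<ge> 0"
  proof -
    have "bounded (H ` cball 0 R)"
      by (intro compact_imp_bounded compact_continuous_image continuous_on_subset[OF cH]) auto
    then obtain K where K: "\<forall>y \<in> H ` cball 0 R. norm y \<le> K" unfolding bounded_iff by blast
    have "\<bar>H x\<bar> \<le> max K 0" for x
    proof (cases "norm x \<le> R")
      case True
      then have "\<bar>H x\<bar> \<le> K" using K by auto
      then show ?thesis by simp
    qed (use suppG[of x] in \<open>simp add: H_def\<close>)
    then show ?thesis using that by force
  qed
  define h where "h n = inverse (real (Suc n))" for n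
  have h: "0 < h n" "h n \<le> 1" for n by (auto simp: h_def inverse_le_1_iff)
  have h0: "filterlim h (at 0) sequentially"
    unfolding filterlim_at using LIMSEQ_inverse_real_of_nat h(1)
    by (auto simp: h_def[abs_def] intro!: always_eventually)
  define Q where "Q n x = (\<Phi> ((1 + h n) *\<^sub>R x) - \<Phi> x) / h n * norm x powr (-s)" for n x
  \<comment> \<open>If (1 + h) x with h <= 1 meets the support, then |x| >= r / 2. The outer radius
    stays R because the dilation only enlarges |x|.\<close>
  let ?A = "cball (0::'a) R - ball 0 (r / 2)"
  have "(\<lambda>n. \<integral>x. Q n x \<partial>lborel) \<longlonglongrightarrow> (\<integral>x. H x * norm x powr (-s) \<partial>lborel)"
  proof (rule integral_dominated_convergence)
    show "integrable lborel (\<lambda>x. indicator ?A x *\<^sub>R (K * norm x powr (-s)))"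
    proof (rule borel_integrable_compact)
      show "compact ?A" by (intro compact_diff) auto
      show "continuous_on ?A (\<lambda>x. K * norm x powr (-s))"
        using r by (intro continuous_intros) auto
    qed
    show "AE x in lborel. (\<lambda>n. Q n x) \<longlonglongrightarrow> H x * norm x powr (-s)"
    proof (rule AE_I2)
      fix x :: 'a
      have "((\<lambda>h. (\<Phi> ((1 + h) *\<^sub>R x) - \<Phi> (1 *\<^sub>R x)) / h) \<longlongrightarrow> H (1 *\<^sub>R x) / 1) (at 0)"
        using ray[OF one_neq_zero, of x] unfolding DERIV_def .
      then have "(\<lambda>n. (\<Phi> ((1 + h n) *\<^sub>R x) - \<Phi> x) / h n) \<longlonglongrightarrow> H x"
        using filterlim_compose[OF _ h0] by fastforce
      then show "(\<lambda>n. Q n x) \<longlonglongrightarrow> H x * norm x powr (-s)"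
        unfolding Q_def by (intro tendsto_mult tendsto_const)
    qed
    show "AE x in lborel. norm (Q n x) \<le> indicator ?A x *\<^sub>R (K * norm x powr (-s))" for n
    proof (rule AE_I2)
      fix x :: 'a
      show "norm (Q n x) \<le> indicator ?A x *\<^sub>R (K * norm x powr (-s))"
      proof (cases "x \<in> ?A")
        case True
        \<comment> \<open>Mean value theorem along the ray; as z > 1, the division by z only helps,
          and K dominates the quotient uniformly in n.\<close>
        have "\<exists>z. 1 < z \<and> z < 1 + h n \<and> \<Phi> ((1 + h n) *\<^sub>R x) - \<Phi> (1 *\<^sub>R x) = (1 + h n - 1) * (H (z *\<^sub>R x) / z)"
          using h(1)[of n] by (intro MVT2 ray) auto
        then obtain z where z: "1 < z" "\<Phi> ((1 + h n) *\<^sub>R x) - \<Phi> x = h n * (H (z *\<^sub>R x) / z)" by auto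
        have "\<bar>H (z *\<^sub>R x) / z\<bar> \<le> \<bar>H (z *\<^sub>R x)\<bar>" using z by (simp add: divide_le_eq mult_left_le abs_mult mult_le_cancel_left1)
        then have "\<bar>(\<Phi> ((1 + h n) *\<^sub>R x) - \<Phi> x) / h n\<bar> \<le> K"
          using z K(1)[of "z *\<^sub>R x"] h(1)[of n] by simp
        then have "\<bar>(\<Phi> ((1 + h n) *\<^sub>R x) - \<Phi> x) / h n\<bar> * norm x powr (-s) \<le> K * norm x powr (-s)"
          by (intro mult_right_mono) auto
        then show ?thesis using True by (simp add: Q_def abs_mult)
      next
        case False
        have n: "norm ((1 + h n) *\<^sub>R x) = (1 + h n) * norm x" using h(1)[of n] by simp
        have "norm x < r / 2 \<or> R < norm x" using False by auto
        then have "\<Phi> ((1 + h n) *\<^sub>R x) = 0 \<and> \<Phi> x = 0"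
        proof
          assume "norm x < r / 2"
          moreover have "(1 + h n) * norm x \<le> 2 * norm x" using h(2)[of n] by (intro mult_right_mono) auto
          ultimately show ?thesis unfolding n[symmetric] using r by (intro conjI \<Phi>0) auto
        next
          assume "R < norm x"
          moreover have "1 * norm x \<le> (1 + h n) * norm x" using h(1)[of n] by (intro mult_right_mono) auto
          ultimately show ?thesis unfolding n[symmetric] by (intro conjI \<Phi>0) auto
        qed
        then show ?thesis using False by (simp add: Q_def)
      qed
    qed
  qed (unfold Q_def, measurable)
  \<comment> \<open>Scaling evaluates the same integral exactly, which exhibits its limit as the
    derivative of t^(s - DIM) at t = 1, times I.\<close>
  moreover have "(\<integral>x. Q n x \<partial>lborel) = ((1 + h n) powr (s - DIM('a)) - 1) / h n * I" for n
  proof -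
    let ?t = "1 + h n"
    have t: "?t > 0" using h(1)[of n] by simp
    let ?g = "\<lambda>x. \<Phi> x * norm x powr (-s)"
    have int: "integrable lborel ?g" by (rule integrable_annulus_powr[OF c\<Phi> r \<Phi>0])
    have "\<Phi> (q *\<^sub>R x) * norm x powr (-s) = q powr s * ?g (q *\<^sub>R x)" if "q > 0" for q x
      using that by (simp add: powr_mult powr_minus field_simps)
    note sc = this[OF t]
    have int': "integrable lborel (\<lambda>x. \<Phi> (?t *\<^sub>R x) * norm x powr (-s))"
    proof (rule integrable_annulus_powr[where r = "r / ?t" and R = "R / ?t"])
      show "continuous_on UNIV (\<lambda>x. \<Phi> (?t *\<^sub>R x))"
        by (intro continuous_on_compose2[OF c\<Phi>] continuous_intros) auto
      show "0 < r / ?t" using r t by simp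
      show "\<Phi> (?t *\<^sub>R x) = 0" if "norm x < r / ?t \<or> R / ?t < norm x" for x
        using that t by (intro \<Phi>0) (auto simp: pos_less_divide_eq pos_divide_less_eq mult.commute)
    qed
    have "(\<integral>x. \<Phi> (?t *\<^sub>R x) * norm x powr (-s) \<partial>lborel) = ?t powr s * (\<integral>x. ?g (?t *\<^sub>R x) \<partial>lborel)"
      unfolding sc by simp
    also have "\<dots> = ?t powr s * (inverse ?t ^ DIM('a) * I)"
      unfolding I_def using t by (subst integral_lborel_scaleR) auto
    also have "\<dots> = ?t powr (s - DIM('a)) * I"
      using t by (simp add: powr_diff powr_realpow power_inverse field_simps)
    finally have 1: "(\<integral>x. \<Phi> (?t *\<^sub>R x) * norm x powr (-s) \<partial>lborel) = ?t powr (s - DIM('a)) * I" .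
    have "(\<integral>x. Q n x \<partial>lborel) = (\<integral>x. (\<Phi> (?t *\<^sub>R x) * norm x powr (-s) - ?g x) / h n \<partial>lborel)"
      by (intro Bochner_Integration.integral_cong) (auto simp: Q_def diff_divide_distrib left_diff_distrib)
    also have "\<dots> = (?t powr (s - DIM('a)) * I - I) / h n"
      using int int' 1 by (simp add: I_def)
    finally show ?thesis by (simp add: algebra_simps diff_divide_distrib)
  qed
  moreover have "(\<lambda>n. ((1 + h n) powr (s - DIM('a)) - 1) / h n * I) \<longlonglongrightarrow> (s - DIM('a)) * I"
  proof (rule tendsto_mult[OF _ tendsto_const])
    have "((\<lambda>t. t powr (s - DIM('a))) has_real_derivative (s - DIM('a))) (at 1)"
      by (auto intro!: derivative_eq_intros)
    then have "((\<lambda>h. ((1 + h) powr (s - DIM('a)) - 1) / h) \<longlongrightarrow> (s - DIM('a))) (at 0)"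
      by (simp add: DERIV_def)
    from filterlim_compose[OF this h0]
    show "(\<lambda>n. ((1 + h n) powr (s - DIM('a)) - 1) / h n) \<longlonglongrightarrow> s - DIM('a)" by simp
  qed
  ultimately have "(\<integral>x. H x * norm x powr (-s) \<partial>lborel) = (s - DIM('a)) * I"
    using LIMSEQ_unique by force
  then show ?thesis unfolding H_def I_def \<Phi>_def .
qed

text \<open>The exponent may be negative; continuity at the origin comes from u and G vanishing on a
  ball, which is glued to the punctured space.\<close>

lemma continuous_on_add_radial:
  fixes u :: "'a::euclidean_space \<Rightarrow> real" and G :: "'a \<Rightarrow> 'a" and m e r :: real
  assumes r: "0 < r" and cG: "continuous_on UNIV G" and cu: "continuous_on UNIV u"
    and zero: "\<And>x. norm x < r \<Longrightarrow> u x = 0" "\<And>x. norm x < r \<Longrightarrow> G x = 0"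
  shows "continuous_on UNIV (\<lambda>x. G x + (m * u x * norm x powr e) *\<^sub>R x)" (is "continuous_on _ ?D")
proof -
  have "continuous_on (UNIV - {0}) ?D"
    by (intro continuous_intros continuous_on_subset[OF cG] continuous_on_subset[OF cu]) auto
  then have "continuous_on (ball 0 r \<union> (UNIV - {0})) ?D"
  proof (rule continuous_on_open_Un[rotated 3])
    have "continuous_on (ball 0 r) (\<lambda>x::'a. 0 :: 'a)" by simp
    then show "continuous_on (ball 0 r) ?D"
      by (rule continuous_on_eq) (simp add: zero)
  qed auto
  moreover have "ball 0 r \<union> (UNIV - {0}) = (UNIV :: 'a set)" using r by auto
  ultimately show ?thesis by simp
qed

text \<open>For v = exp (-\<mu> |x|^\<gamma> / \<gamma>) with \<gamma> = b - a + 1, the vector on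
  the left is v \<nabla>(u / v) when G = \<nabla>u, so it measures the distance of u from the
  multiples of v. The inequality is strict convexity of the p-th power of the norm around X = -\<mu>
  u |x|^(b-a-1) x, with increment G - X.\<close>

lemma deficit_lower_bound:
  fixes u :: "'a::euclidean_space \<Rightarrow> real" and G :: "'a \<Rightarrow> 'a" and p a b \<mu> s :: real
  assumes p: "2 \<le> p" and r: "0 < r" and \<mu>: "0 < \<mu>"
    and der: "\<And>x. (u has_derivative (\<lambda>h. G x \<bullet> h)) (at x)" and cont: "continuous_on UNIV G"
    and supp: "\<And>x. norm x < r \<or> R < norm x \<Longrightarrow> u x = 0"
    and suppG: "\<And>x. norm x < r \<or> R < norm x \<Longrightarrow> G x = 0"
  defines "\<kappa> \<equiv> min (1/2) (p / 2 * (4 * p + 2) powr (2 - p))"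
    and "s \<equiv> (p - 1) * a + b + 1"
  shows "\<kappa> * (\<integral>x. norm (G x + (\<mu> * u x * norm x powr (b - a - 1)) *\<^sub>R x) powr p * norm x powr (- (p * b)) \<partial>lborel)
    \<le> (\<integral>x. norm (G x) powr p * norm x powr (- (p * b)) \<partial>lborel)
      + (p - 1) * \<mu> powr p * (\<integral>x. \<bar>u x\<bar> powr p * norm x powr (- (p * a)) \<partial>lborel)
      - \<mu> powr (p - 1) * (DIM('a) - s) * (\<integral>x. \<bar>u x\<bar> powr p * norm x powr (-s) \<partial>lborel)"
proof -
  have cu: "continuous_on UNIV u" using der
    by (meson continuous_at_imp_continuous_on has_derivative_continuous)
  let ?e = "b - a - 1"
  define D where "D x = G x + (\<mu> * u x * norm x powr ?e) *\<^sub>R x" for x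
  define P where "P x = p * (\<bar>u x\<bar> powr (p - 1) * sgn (u x) * (G x \<bullet> x))" for x
  have cD: "continuous_on UNIV D" unfolding D_def
    by (rule continuous_on_add_radial[OF r cont cu]) (use supp suppG in auto)
  have suppD: "D x = 0" if "norm x < r \<or> R < norm x" for x using supp[OF that] suppG[OF that] by (simp add: D_def)
  have "integrable lborel (\<lambda>x. norm (D x) powr p * norm x powr (- (p * b)))"
    by (rule integrable_annulus_powr[OF _ r, where R = R])
       (use p suppD in \<open>auto intro!: continuous_intros cD continuous_on_powr'\<close>)
  note iD = this
  have iG: "integrable lborel (\<lambda>x. norm (G x) powr p * norm x powr (- (p * b)))"
    by (rule integrable_annulus_powr[OF _ r, where R = R])
       (use p suppG in \<open>auto intro!: continuous_intros cont continuous_on_powr'\<close>)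
  have iu: "integrable lborel (\<lambda>x. \<bar>u x\<bar> powr p * norm x powr e)" for e
    by (rule integrable_annulus_powr[OF _ r, where R = R])
       (use p supp in \<open>auto intro!: continuous_intros cu continuous_on_powr'\<close>)
  have cP: "continuous_on UNIV P" unfolding P_def using p
    by (intro continuous_intros cont continuous_on_compose2[OF continuous_on_sgn_powr cu]) auto
  have iP: "integrable lborel (\<lambda>x. P x * norm x powr (-s))"
    by (rule integrable_annulus_powr[OF cP r, where R = R]) (use supp in \<open>auto simp: P_def\<close>)
  have IP: "(\<integral>x. P x * norm x powr (-s) \<partial>lborel) = (s - DIM('a)) * (\<integral>x. \<bar>u x\<bar> powr p * norm x powr (-s) \<partial>lborel)"
    unfolding P_def by (rule integral_radial_derivative[OF _ r der cont supp suppG]) (use p in auto)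
  have pt: "\<kappa> * (norm (D x) powr p * norm x powr (- (p * b)))
      \<le> norm (G x) powr p * norm x powr (- (p * b)) + (p - 1) * \<mu> powr p * (\<bar>u x\<bar> powr p * norm x powr (- (p * a)))
        + \<mu> powr (p - 1) * (P x * norm x powr (-s))" for x
  proof (cases "x = 0")
    case True
    then show ?thesis using p r supp[of 0] suppG[of 0] by (simp add: D_def P_def)
  next
    case False
    then have x: "norm x > 0" by simp
    define X where "X = - (\<mu> * u x * norm x powr ?e) *\<^sub>R x"
    let ?w = "norm x powr (- (p * b))"
    have GX: "X + D x = G x" by (simp add: X_def D_def)
    have nX: "norm X = \<mu> * \<bar>u x\<bar> * norm x powr (b - a)"
      using \<mu> x by (simp add: X_def abs_mult powr_diff)
    have 1: "norm X powr p * ?w = \<mu> powr p * (\<bar>u x\<bar> powr p * norm x powr (- (p * a)))"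
    proof -
      have "norm X powr p = \<mu> powr p * \<bar>u x\<bar> powr p * norm x powr ((b - a) * p)"
        unfolding nX using \<mu> by (simp add: powr_mult powr_powr)
      moreover have "norm x powr ((b - a) * p) * ?w = norm x powr (- (p * a))"
        by (simp add: powr_add[symmetric] algebra_simps)
      ultimately show ?thesis by (simp add: mult.assoc)
    qed
    \<comment> \<open>The cross term is a radial derivative of |u|^p: the exponents (b - a)(p - 2),
      b - a - 1 and -pb add up to -s.\<close>
    have 2: "norm X powr (p - 2) * (X \<bullet> G x) * ?w = - (\<mu> powr (p - 1) * (P x / p * norm x powr (-s)))"
    proof (cases "u x = 0")
      case True
      then show ?thesis by (simp add: X_def P_def)
    next
      case False
      have "norm X powr (p - 2) = \<mu> powr (p - 2) * \<bar>u x\<bar> powr (p - 2) * norm x powr ((b - a) * (p - 2))"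
        unfolding nX using \<mu> by (simp add: powr_mult powr_powr)
      moreover have "X \<bullet> G x = - (\<mu> * u x * norm x powr ?e * (G x \<bullet> x))"
        by (simp add: X_def inner_commute)
      ultimately have "norm X powr (p - 2) * (X \<bullet> G x) * ?w
         = - ((\<mu> powr (p - 2) * \<mu>) * (\<bar>u x\<bar> powr (p - 2) * u x) * (G x \<bullet> x) * (norm x powr ((b - a) * (p - 2)) * norm x powr ?e * ?w))"
        by (simp add: mult_ac)
      also have "\<mu> powr (p - 2) * \<mu> = \<mu> powr (p - 1)"
        using powr_add[of \<mu> "p - 2" 1] \<mu> by simp
      also have "\<bar>u x\<bar> powr (p - 2) * u x = \<bar>u x\<bar> powr (p - 1) * sgn (u x)"
        using powr_add[of "\<bar>u x\<bar>" "p - 2" 1] False by (simp add: sgn_real_def abs_if)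
      also have "norm x powr ((b - a) * (p - 2)) * norm x powr ?e * ?w = norm x powr (-s)"
        by (simp add: powr_add[symmetric] s_def algebra_simps)
      finally show ?thesis using p by (simp add: P_def mult_ac)
    qed
    \<comment> \<open>Because the increment is G - X, the cross term also contributes -p |X|^p;
      together with the leading |X|^p this leaves (p - 1) |X|^p on the other side.\<close>
    have 3: "norm X powr (p - 2) * (X \<bullet> X) = norm X powr p"
      using powr_add[of "norm X" "p - 2" 2] by (cases "X = 0") (auto simp: power2_norm_eq_inner)
    have "norm X powr p + p * norm X powr (p - 2) * (X \<bullet> D x) + \<kappa> * norm (D x) powr p \<le> norm (G x) powr p"
      using norm_powr_strictly_convex[OF p, of X "D x"] unfolding GX \<kappa>_def .
    then have "(norm X powr p + p * norm X powr (p - 2) * (X \<bullet> D x) + \<kappa> * norm (D x) powr p) * ?w \<le> norm (G x) powr p * ?w"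
      by (intro mult_right_mono) auto
    moreover have "X \<bullet> D x = X \<bullet> G x - X \<bullet> X" unfolding GX[symmetric] by (simp add: inner_add_right)
    ultimately have "norm X powr p * ?w + p * (norm X powr (p - 2) * (X \<bullet> G x) * ?w) - p * (norm X powr (p - 2) * (X \<bullet> X) * ?w)
        + \<kappa> * (norm (D x) powr p * ?w) \<le> norm (G x) powr p * ?w"
      by (simp add: algebra_simps)
    then have "\<kappa> * (norm (D x) powr p * ?w)
        \<le> norm (G x) powr p * ?w + (p - 1) * (norm X powr p * ?w) - p * (norm X powr (p - 2) * (X \<bullet> G x) * ?w)"
      unfolding 3 by (simp add: algebra_simps)
    also have "p * (norm X powr (p - 2) * (X \<bullet> G x) * ?w) = - (\<mu> powr (p - 1) * (P x * norm x powr (-s)))"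
      unfolding 2 using p by simp
    finally show ?thesis unfolding 1 by (simp add: mult.assoc)
  qed
  have "\<kappa> * (\<integral>x. norm (D x) powr p * norm x powr (- (p * b)) \<partial>lborel)
      = (\<integral>x. \<kappa> * (norm (D x) powr p * norm x powr (- (p * b))) \<partial>lborel)" by simp
  also have "\<dots> \<le> (\<integral>x. norm (G x) powr p * norm x powr (- (p * b)) + (p - 1) * \<mu> powr p * (\<bar>u x\<bar> powr p * norm x powr (- (p * a)))
        + \<mu> powr (p - 1) * (P x * norm x powr (-s)) \<partial>lborel)"
    by (intro integral_mono pt Bochner_Integration.integrable_add integrable_mult_right iD iG iu iP)
  also have "\<dots> = (\<integral>x. norm (G x) powr p * norm x powr (- (p * b)) \<partial>lborel)
      + (p - 1) * \<mu> powr p * (\<integral>x. \<bar>u x\<bar> powr p * norm x powr (- (p * a)) \<partial>lborel)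
      + \<mu> powr (p - 1) * ((s - DIM('a)) * (\<integral>x. \<bar>u x\<bar> powr p * norm x powr (-s) \<partial>lborel))"
    using iG iu iP by (simp add: IP)
  finally show ?thesis unfolding D_def by (simp add: algebra_simps)
qed

subsection \<open>Stability\<close>

lemma has_derivative_gradient:
  fixes u :: "real ^ 'n \<Rightarrow> real"
  assumes "u differentiable (at x)"
  shows "(u has_derivative (\<lambda>h. gradient u x \<bullet> h)) (at x)"
proof -
  let ?D = "frechet_derivative u (at x)"
  have D: "(u has_derivative ?D) (at x)" using assms frechet_derivative_works by blast
  then have lin: "linear ?D" by (rule has_derivative_linear)
  have "?D h = gradient u x \<bullet> h" for h
  proof -
    have "?D h = ?D (\<Sum>i\<in>UNIV. (h $ i) *\<^sub>R axis i 1)"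
      using basis_expansion[of h] by (simp add: scalar_mult_eq_scaleR)
    also have "\<dots> = gradient u x \<bullet> h"
      by (simp add: linear_sum[OF lin] linear_cmul[OF lin] gradient_def inner_vec_def mult.commute)
    finally show ?thesis .
  qed
  then have "?D = (\<lambda>h. gradient u x \<bullet> h)" by (simp add: fun_eq_iff)
  then show ?thesis using D by simp
qed

text \<open>The data on which everything later rests: u is continuously differentiable and lives on
  an annulus, where no weight is singular.\<close>

lemma Cc_smooth_puncturedE:
  fixes u :: "real ^ 'n \<Rightarrow> real"
  assumes u: "u \<in> Cc_smooth_punctured"
  obtains r R where "0 < r"
    "\<And>x. (u has_derivative (\<lambda>h. gradient u x \<bullet> h)) (at x)" "continuous_on UNIV (gradient u)"
    "\<And>x. norm x < r \<or> R < norm x \<Longrightarrow> u x = 0"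
    "\<And>x. norm x < r \<or> R < norm x \<Longrightarrow> gradient u x = 0"
proof -
  let ?S = "closure {x. u x \<noteq> 0}"
  have "k_smooth (Suc 0) u" and S: "compact ?S" "0 \<notin> ?S"
    using u by (auto simp: Cc_smooth_punctured_def)
  then have diff: "u differentiable (at x)" and cD: "continuous_on UNIV (\<lambda>x. frechet_derivative u (at x) v)" for x v
    by auto
  have der: "(u has_derivative (\<lambda>h. gradient u x \<bullet> h)) (at x)" for x
    by (rule has_derivative_gradient[OF diff])
  have cG: "continuous_on UNIV (gradient u)"
    unfolding gradient_def[abs_def] by (intro continuous_on_vec_lambda cD)
  obtain R where R: "\<And>x. x \<in> ?S \<Longrightarrow> norm x \<le> R"
    using compact_imp_bounded[OF S(1)] by (auto simp: bounded_iff)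
  have "open (- ?S)" by (intro open_Compl closed_closure)
  then obtain r where r: "r > 0" "ball 0 r \<subseteq> - ?S"
    using S(2) by (meson ComplI open_contains_ball)
  have zero: "u x = 0" if "norm x < r \<or> R < norm x" for x
  proof -
    have "x \<notin> ?S" using that R[of x] r(2) by (auto simp: subset_iff)
    then show ?thesis using closure_subset[of "{x. u x \<noteq> 0}"] by auto
  qed
  have "gradient u x = 0" if x: "norm x < r \<or> R < norm x" for x
  proof -
    let ?U = "ball 0 r \<union> - cball (0 :: real ^ 'n) R"
    have "((\<lambda>x. 0 :: real) has_derivative (\<lambda>h. 0)) (at x)" by simp
    then have "(u has_derivative (\<lambda>h. 0)) (at x)"
      by (rule has_derivative_transform_within_open[where s = ?U]) (use x zero in auto)
    then have "(\<lambda>h. gradient u x \<bullet> h) = (\<lambda>h. 0)"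
      using der has_derivative_unique by blast
    then show ?thesis by (metis inner_eq_zero_iff)
  qed
  then show ?thesis using that[OF r(1) der cG zero] by blast
qed

lemma integral_annulus_powr_pos:
  fixes g :: "'a::euclidean_space \<Rightarrow> real" and r R e :: real
  assumes cont: "continuous_on UNIV g" and r: "0 < r"
    and supp: "\<And>x. norm x < r \<or> R < norm x \<Longrightarrow> g x = 0"
    and nonneg: "\<And>x. 0 \<le> g x" and pos: "0 < g x0"
  shows "0 < (\<integral>x. g x * norm x powr e \<partial>lborel)"
proof -
  have int: "integrable lborel (\<lambda>x. g x * norm x powr e)"
    by (rule integrable_annulus_powr[OF cont r supp])
  have nn: "0 \<le> (\<integral>x. g x * norm x powr e \<partial>lborel)"
    using nonneg by (intro integral_nonneg_AE) auto
  moreover have "(\<integral>x. g x * norm x powr e \<partial>lborel) \<noteq> 0"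
  proof
    assume "(\<integral>x. g x * norm x powr e \<partial>lborel) = 0"
    then have "AE x in lborel. g x * norm x powr e = 0"
      using integral_nonneg_eq_0_iff_AE[OF int] nonneg by auto
    then have AE: "AE x in lborel. g x = 0"
    proof eventually_elim
      case (elim x)
      then show ?case using supp[of x] r by (cases "x = 0") auto
    qed
    have "open {x. 0 < g x}" using cont by (intro open_Collect_less continuous_on_const) auto
    then obtain d where d: "d > 0" "ball x0 d \<subseteq> {x. 0 < g x}"
      using pos open_contains_ball by blast
    have "AE x in lborel. x \<notin> ball x0 d"
      using AE by eventually_elim (use d(2) in force)
    then have "ball x0 d \<in> null_sets lborel" by (subst AE_iff_null_sets) auto
    then show False using d(1) unit_ball_vol_pos[of "real DIM('a)"] by (simp add: null_sets_def emeasure_ball)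
  qed
  ultimately show ?thesis by linarith
qed

lemma cINF_divide:
  fixes g :: "'i \<Rightarrow> real"
  assumes "I \<noteq> {}" "bdd_below (g ` I)" "0 < B"
  shows "(INF i\<in>I. g i / B) = (INF i\<in>I. g i) / B"
proof (rule antisym)
  have bdd: "bdd_below ((\<lambda>i. g i / B) ` I)"
  proof -
    obtain m where "\<And>i. i \<in> I \<Longrightarrow> m \<le> g i" using assms(2) by (auto simp: bdd_below_def)
    then show ?thesis using assms(3) by (intro bdd_belowI2[where m = "m / B"]) (auto intro: divide_right_mono)
  qed
  have "(INF i\<in>I. g i / B) * B \<le> (INF i\<in>I. g i)"
  proof (rule cINF_greatest[OF assms(1)])
    fix i assume "i \<in> I"
    then have "(INF i\<in>I. g i / B) \<le> g i / B" by (rule cINF_lower[OF bdd])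
    then show "(INF i\<in>I. g i / B) * B \<le> g i" using assms(3) by (simp add: pos_le_divide_eq)
  qed
  then show "(INF i\<in>I. g i / B) \<le> (INF i\<in>I. g i) / B" using assms(3) by (simp add: pos_le_divide_eq)
  show "(INF i\<in>I. g i) / B \<le> (INF i\<in>I. g i / B)"
    using assms by (intro cINF_greatest divide_right_mono cINF_lower) auto
qed

lemma weighted_integral_eq:
  "weighted_integral p s f = (\<integral>x. \<bar>f x\<bar> powr p * norm x powr (- s) \<partial>lborel)"
  by (simp add: weighted_integral_def powr_minus divide_inverse)

lemma weighted_gradient_integral_eq:
  "weighted_gradient_integral p s u = (\<integral>x. norm (gradient u x) powr p * norm x powr (- s) \<partial>lborel)"
  by (simp add: weighted_gradient_integral_def powr_minus divide_inverse)

lemma weighted_integral_nonneg: "0 \<le> weighted_integral p s f"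
  unfolding weighted_integral_eq by (intro integral_nonneg_AE) auto

lemma weighted_integrals_pos:
  fixes u :: "real ^ 'n \<Rightarrow> real" and p s t :: real
  assumes p: "0 < p" and u: "u \<in> Cc_smooth_punctured - {\<lambda>x. 0}"
  shows "0 < weighted_integral p s u" "0 < weighted_gradient_integral p t u"
proof -
  from u have "u \<in> Cc_smooth_punctured" by simp
  then obtain r R where r: "0 < r"
    and der: "\<And>x. (u has_derivative (\<lambda>h. gradient u x \<bullet> h)) (at x)" and cont: "continuous_on UNIV (gradient u)"
    and supp: "\<And>x. norm x < r \<or> R < norm x \<Longrightarrow> u x = 0"
    and suppG: "\<And>x. norm x < r \<or> R < norm x \<Longrightarrow> gradient u x = 0"
    by (rule Cc_smooth_puncturedE) blast
  have cu: "continuous_on UNIV u" using der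
    by (meson continuous_at_imp_continuous_on has_derivative_continuous)
  obtain x0 where x0: "u x0 \<noteq> 0" using u by auto
  show "0 < weighted_integral p s u" unfolding weighted_integral_eq
    by (rule integral_annulus_powr_pos[OF _ r, where R = R and ?x0.0 = x0])
       (use p x0 supp in \<open>auto intro!: continuous_intros cu continuous_on_powr'\<close>)
  \<comment> \<open>A gradient vanishing everywhere would make u constant, hence 0, since u vanishes
    near the origin.\<close>
  obtain x1 where x1: "gradient u x1 \<noteq> 0"
  proof (rule ccontr)
    assume "\<not> thesis"
    then have "gradient u x = 0" for x using that by blast
    then have "(u has_derivative (\<lambda>h. 0)) (at x within UNIV)" for x using der[of x] by simp
    then obtain c where "\<And>x. u x = c" using has_derivative_zero_constant[of UNIV u] by auto
    then show False using x0 supp[of 0] r by auto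
  qed
  show "0 < weighted_gradient_integral p t u" unfolding weighted_gradient_integral_eq
    by (rule integral_annulus_powr_pos[OF _ r, where R = R and ?x0.0 = x1])
       (use p x1 suppG in \<open>auto intro!: continuous_intros cont continuous_on_powr'\<close>)
qed

section \<open>Equivalence of the two forms of the inequality\<close>

text \<open>The parameters correspond through \<beta> = -1 / l^(b-a+1); positivity of the exponent
  turns the sign condition in \<open>M_set\<close> into \<beta> < 0.\<close>

lemma M_set_eq:
  assumes "0 < b - a + 1"
  shows "(M_set a b :: (real ^ 'n \<Rightarrow> real) set) = (\<lambda>(c, l). \<lambda>x. c * exp (- (norm x powr (b - a + 1) / ((b - a + 1) * l powr (b - a + 1))))) ` (UNIV \<times> {0<..})"
    (is "_ = ?F ` ?I")
proof (rule set_eqI, rule iffI)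
  let ?\<gamma> = "b - a + 1"
  fix v :: "real ^ 'n \<Rightarrow> real"
  assume "v \<in> M_set a b"
  then obtain \<alpha> \<beta> where v: "v = (\<lambda>x. \<alpha> * exp (\<beta> / ?\<gamma> * norm x powr ?\<gamma>))" and "\<beta> / ?\<gamma> < 0"
    by (auto simp: M_set_def)
  then have \<beta>: "\<beta> < 0" using assms by (simp add: divide_less_0_iff)
  define l where "l = (- \<beta>) powr (- 1 / ?\<gamma>)"
  have "l > 0" using \<beta> by (simp add: l_def)
  moreover have "l powr ?\<gamma> = 1 / (- \<beta>)"
    using \<beta> assms unfolding l_def powr_powr by (simp add: powr_minus_divide)
  then have "v = ?F (\<alpha>, l)" unfolding v using assms by (auto simp: fun_eq_iff)
  ultimately show "v \<in> ?F ` ?I" by blast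
next
  let ?\<gamma> = "b - a + 1"
  fix v :: "real ^ 'n \<Rightarrow> real"
  assume "v \<in> ?F ` ?I"
  then obtain c l where l: "l > 0" and v: "v = ?F (c, l)" by auto
  have "v = (\<lambda>x. c * exp ((- 1 / l powr ?\<gamma>) / ?\<gamma> * norm x powr ?\<gamma>))"
    unfolding v by (auto simp: fun_eq_iff mult.commute)
  moreover have "(- 1 / l powr ?\<gamma>) / ?\<gamma> < 0" using l assms by (simp add: divide_neg_pos)
  ultimately show "v \<in> M_set a b" unfolding M_set_def by blast
qed

text \<open>Division by P = A^(1/p) B^((p-1)/p), which is positive. Since P / B = (A / B)^(1/p), the
  prefactor of the infimum becomes 1 / B, and this moves inside the infimum.\<close>

lemma stability_ineq_iff_normalized:
  fixes u :: "real ^ 'n \<Rightarrow> real"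
  assumes p: "1 < p" and \<gamma>: "0 < b - a + 1" and u: "u \<in> Cc_smooth_punctured - {\<lambda>x. 0}"
  shows "stability_ineq p a b C u \<longleftrightarrow> normalized_stability_ineq p a b C u"
proof -
  define A where "A = weighted_gradient_integral p (p * b) u"
  define B where "B = weighted_integral p (p * a) u"
  define Q where "Q = (real CARD('n) - (p - 1) * a - b - 1) / p * weighted_integral p ((p - 1) * a + b + 1) u"
  define P where "P = A powr (1 / p) * B powr ((p - 1) / p)"
  let ?F = "\<lambda>(c, l). \<lambda>x::real^'n. c * exp (- (norm x powr (b - a + 1) / ((b - a + 1) * l powr (b - a + 1))))"
  let ?I = "UNIV \<times> {0<..} :: (real \<times> real) set"
  define W where "W i = weighted_integral p (p * a) (\<lambda>x. u x - ?F i x)" for i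
  define J where "J = (INF i\<in>?I. W i)"
  have A: "A > 0" and B: "B > 0" using weighted_integrals_pos[OF _ u] p by (auto simp: A_def B_def)
  have P: "P > 0" using A B by (simp add: P_def)
  have PB: "P / B = (A / B) powr (1 / p)"
  proof -
    have "(p - 1) / p - 1 = - (1 / p)" using p by (simp add: field_simps)
    then have "B powr ((p - 1) / p) / B = B powr (- (1 / p))"
      using B powr_diff[of B "(p - 1) / p" 1] by simp
    then show ?thesis using A B
      unfolding P_def times_divide_eq_right[symmetric] by (simp add: powr_divide powr_minus_divide)
  qed
  have J: "(INF (c, l) \<in> ?I. weighted_integral p (p * a)
             (\<lambda>x. u x - c * exp (- (norm x powr (b - a + 1) / ((b - a + 1) * l powr (b - a + 1)))))) = J"
    unfolding J_def W_def by (intro INF_cong) auto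
  have "(INF v \<in> M_set a b. weighted_integral p (p * a) (\<lambda>x. u x - v x) / B) = (INF i\<in>?I. W i / B)"
    unfolding M_set_eq[OF \<gamma>] image_image W_def by simp
  also have "\<dots> = J / B" unfolding J_def
    by (rule cINF_divide)
       (use B weighted_integral_nonneg in \<open>auto simp: W_def intro!: bdd_belowI2[where m = 0]\<close>)
  finally have J': "(INF v \<in> M_set a b. weighted_integral p (p * a) (\<lambda>x. u x - v x) / B) = J / B" .
  have "stability_ineq p a b C u \<longleftrightarrow> C * (P / B) * J \<le> P - Q"
    unfolding stability_ineq_def A_def[symmetric] B_def[symmetric] Q_def[symmetric] P_def[symmetric] J PB[symmetric] ..
  also have "\<dots> \<longleftrightarrow> (C * (J / B)) * P \<le> (1 - Q / P) * P"
    using P by (simp add: algebra_simps)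
  also have "\<dots> \<longleftrightarrow> C * (J / B) \<le> 1 - Q / P"
    using P by (rule mult_le_cancel_right_pos)
  also have "\<dots> \<longleftrightarrow> normalized_stability_ineq p a b C u"
    unfolding normalized_stability_ineq_def A_def[symmetric] B_def[symmetric] Q_def[symmetric] P_def[symmetric] J' ..
  finally show ?thesis .
qed

section \<open>Existence of the universal constant\<close>

text \<open>The constant is fixed before u appears, because K belongs to the rate p / \<gamma> and
  \<mu> enters by scaling only. The infimum is then bounded by its value at one candidate, the
  multiple c v supplied by the Poincare inequality.\<close>

lemma stability_ineq_exists:
  fixes p a b :: real
  assumes p: "2 \<le> p" and b: "0 \<le> b" and a: "0 \<le> a" "p * a < CARD('n::finite)" and \<gamma>: "0 < b - a + 1"
  shows "\<exists>C>0. \<forall>u :: real ^ 'n \<Rightarrow> real. u \<in> Cc_smooth_punctured - {\<lambda>x. 0} \<longrightarrow> stability_ineq p a b C u"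
proof -
  define \<gamma> where "\<gamma> = b - a + 1"
  define \<sigma> where "\<sigma> = p * a"
  define \<tau> where "\<tau> = p * b"
  define \<kappa> where "\<kappa> = min (1/2) (p / 2 * (4 * p + 2) powr (2 - p))"
  define s where "s = (p - 1) * a + b + 1"
  have \<kappa>: "\<kappa> > 0" using p by (simp add: \<kappa>_def)
  have \<gamma>0: "0 < \<gamma>" using \<gamma> by (simp add: \<gamma>_def)
  have p1: "1 < p" "0 < p" using p by auto
  have \<sigma>: "0 \<le> \<sigma>" "\<sigma> < DIM(real ^ 'n)" using a p by (simp_all add: \<sigma>_def)
  have \<tau>: "0 \<le> \<tau>" "\<sigma> = \<tau> + p * (1 - \<gamma>)" using b p by (simp_all add: \<tau>_def \<sigma>_def \<gamma>_def algebra_simps)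
  have k: "0 < p / \<gamma>" using \<gamma>0 p by simp
  obtain K where K: "0 < K" and Poincare: "\<And>(f :: real ^ 'n \<Rightarrow> real) G \<mu>. 0 < \<mu> \<Longrightarrow> (\<And>x. (f has_derivative (\<lambda>h. G x \<bullet> h)) (at x)) \<Longrightarrow> continuous_on UNIV G \<Longrightarrow>
      \<exists>c. (\<integral>\<^sup>+x. ennreal (\<bar>f x - c\<bar> powr p) * ennreal (exp_weight \<sigma> \<gamma> (\<mu> * (p / \<gamma>)) x) \<partial>lborel) < \<infinity> \<longrightarrow>
        (\<integral>\<^sup>+x. ennreal (\<bar>f x - c\<bar> powr p) * ennreal (exp_weight \<sigma> \<gamma> (\<mu> * (p / \<gamma>)) x) \<partial>lborel)
        \<le> ennreal (K * \<mu> powr (-p)) * (\<integral>\<^sup>+x. ennreal (norm (G x) powr p) * ennreal (exp_weight \<tau> \<gamma> (\<mu> * (p / \<gamma>)) x) \<partial>lborel)"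
    using Poincare_exp_weight_scaled[OF p1(1) \<sigma> \<gamma>0 k \<tau>] by blast
  \<comment> \<open>\<kappa> comes from strict convexity, K from the Poincare inequality, and p from
    the factor p \<mu>^(p-1) in front of the left-hand side.\<close>
  define C where "C = \<kappa> / (p * K)"
  have C: "C > 0" using \<kappa> K p by (simp add: C_def)
  have "stability_ineq p a b C u" if u: "u \<in> Cc_smooth_punctured - {\<lambda>x. 0}" for u :: "real ^ 'n \<Rightarrow> real"
  proof -
    from u have "u \<in> Cc_smooth_punctured" by simp
    then obtain r R where r: "0 < r"
      and der: "\<And>x. (u has_derivative (\<lambda>h. gradient u x \<bullet> h)) (at x)" and cont: "continuous_on UNIV (gradient u)"
      and supp: "\<And>x. norm x < r \<or> R < norm x \<Longrightarrow> u x = 0"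
      and suppG: "\<And>x. norm x < r \<or> R < norm x \<Longrightarrow> gradient u x = 0"
      by (rule Cc_smooth_puncturedE) blast
    have cu: "continuous_on UNIV u" using der
      by (meson continuous_at_imp_continuous_on has_derivative_continuous)
    note [measurable] = borel_measurable_continuous_onI[OF cu]
    define A where "A = weighted_gradient_integral p (p * b) u"
    define B where "B = weighted_integral p (p * a) u"
    define S where "S = weighted_integral p s u"
    define \<mu> where "\<mu> = (A / B) powr (1 / p)"
    have A: "A > 0" and B: "B > 0" using weighted_integrals_pos[OF p1(2) u] by (auto simp: A_def B_def)
    have \<mu>: "\<mu> > 0" using A B by (simp add: \<mu>_def)
    have \<mu>p: "\<mu> powr p * B = A" using A B p by (simp add: \<mu>_def powr_powr)
    have AB: "A powr (1 / p) * B powr ((p - 1) / p) = \<mu> * B"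
    proof -
      have "B powr ((p - 1) / p) = B / B powr (1 / p)"
        using B p powr_diff[of B 1 "1 / p"] by (simp add: diff_divide_distrib)
      then show ?thesis using A B by (simp add: \<mu>_def powr_divide)
    qed
    \<comment> \<open>The reciprocal of v, so that u w is the quotient u / v; its gradient is w
      D.\<close>
    define w where "w x = exp (\<mu> / \<gamma> * norm x powr \<gamma>)" for x :: "real ^ 'n"
    define D where "D x = gradient u x + (\<mu> * u x * norm x powr (b - a - 1)) *\<^sub>R x" for x
    define T where "T = (\<integral>x. norm (D x) powr p * norm x powr (- (p * b)) \<partial>lborel)"
    have cD: "continuous_on UNIV D" unfolding D_def
      by (rule continuous_on_add_radial[OF r cont cu]) (use supp suppG in auto)
    note [measurable] = borel_measurable_continuous_onI[OF cD]
    have suppD: "D x = 0" if "norm x < r \<or> R < norm x" for x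
      using supp[OF that] suppG[OF that] by (simp add: D_def)
    have T0: "T \<ge> 0" unfolding T_def by (intro integral_nonneg_AE) auto
    have deficit: "\<kappa> * T \<le> A + (p - 1) * \<mu> powr p * B - \<mu> powr (p - 1) * (CARD('n) - s) * S"
      using deficit_lower_bound[where R = R and a = a and b = b, OF p r \<mu> der cont supp suppG]
      unfolding T_def D_def A_def B_def S_def weighted_integral_eq weighted_gradient_integral_eq \<kappa>_def s_def by simp
    \<comment> \<open>Away from 0 this is the product rule; at 0, where |x|^\<gamma> need not be
      differentiable, u vanishes on a neighbourhood.\<close>
    have wder: "((\<lambda>x. u x * w x) has_derivative (\<lambda>h. (w x *\<^sub>R D x) \<bullet> h)) (at x)" for x
    proof (cases "x = 0")
      case True
      have "((\<lambda>x. 0 :: real) has_derivative (\<lambda>h. 0)) (at x)" by simp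
      then have "((\<lambda>x. u x * w x) has_derivative (\<lambda>h. 0)) (at x)"
        by (rule has_derivative_transform_within_open[where s = "ball 0 r"]) (use True r supp in auto)
      then show ?thesis using True r supp[of 0] suppG[of 0] by (simp add: D_def)
    next
      case False
      have n: "(norm has_derivative (\<lambda>h. (x \<bullet> h) / norm x)) (at x)"
        using has_derivative_norm[OF False] by (simp add: sgn_div_norm inner_commute divide_inverse mult.commute)
      have pw: "((\<lambda>t. exp (\<mu> / \<gamma> * t powr \<gamma>)) has_real_derivative exp (\<mu> / \<gamma> * norm x powr \<gamma>) * (\<mu> * norm x powr (\<gamma> - 1))) (at (norm x))"
        using False \<gamma>0 by (auto intro!: derivative_eq_intros)
      have "(w has_derivative (\<lambda>h. w x * (\<mu> * norm x powr (\<gamma> - 1)) * ((x \<bullet> h) / norm x))) (at x)"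
        using has_derivative_compose[OF n pw[unfolded has_field_derivative_def]]
        unfolding w_def[abs_def] .
      moreover have "w x * (\<mu> * norm x powr (\<gamma> - 1)) * ((x \<bullet> h) / norm x)
          = w x * (\<mu> * norm x powr (b - a - 1) * (x \<bullet> h))" for h
      proof -
        have "norm x powr (b - a - 1) = norm x powr (\<gamma> - 1) / norm x"
          using False powr_diff[of "norm x" "\<gamma> - 1" 1] by (simp add: \<gamma>_def)
        then show ?thesis by simp
      qed
      ultimately have "(w has_derivative (\<lambda>h. w x * (\<mu> * norm x powr (b - a - 1) * (x \<bullet> h)))) (at x)"
        by simp
      from has_derivative_mult[OF der this] show ?thesis
        by (rule has_derivative_eq_rhs) (simp add: D_def fun_eq_iff inner_add_left algebra_simps)
    qed
    have cwD: "continuous_on UNIV (\<lambda>x. w x *\<^sub>R D x)"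
      unfolding w_def using \<gamma>0 by (intro continuous_intros continuous_on_powr' cD) auto
    have [measurable]: "w \<in> borel_measurable borel" unfolding w_def[abs_def] by measurable
    have ew: "exp_weight \<zeta> \<gamma> (\<mu> * (p / \<gamma>)) x = norm x powr (- \<zeta>) * inverse (w x) powr p" for \<zeta> x
      by (simp add: exp_weight_def w_def exp_minus[symmetric] exp_powr_real algebra_simps)
    have w0: "w x > 0" for x by (simp add: w_def)
    obtain c where c: "(\<integral>\<^sup>+x. ennreal (\<bar>u x * w x - c\<bar> powr p) * ennreal (exp_weight \<sigma> \<gamma> (\<mu> * (p / \<gamma>)) x) \<partial>lborel) < \<infinity> \<longrightarrow>
        (\<integral>\<^sup>+x. ennreal (\<bar>u x * w x - c\<bar> powr p) * ennreal (exp_weight \<sigma> \<gamma> (\<mu> * (p / \<gamma>)) x) \<partial>lborel)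
        \<le> ennreal (K * \<mu> powr (-p)) * (\<integral>\<^sup>+x. ennreal (norm (w x *\<^sub>R D x) powr p) * ennreal (exp_weight \<tau> \<gamma> (\<mu> * (p / \<gamma>)) x) \<partial>lborel)"
      using Poincare[OF \<mu> wder cwD] by blast
    \<comment> \<open>The exponential in the weight is w^(-p) = v^p, so it turns |u w - c|^p back
      into |u - c v|^p.\<close>
    have X: "ennreal (\<bar>u x * w x - c\<bar> powr p) * ennreal (exp_weight \<sigma> \<gamma> (\<mu> * (p / \<gamma>)) x)
        = ennreal (\<bar>u x - c * inverse (w x)\<bar> powr p * norm x powr (- (p * a)))" for x
    proof -
      have "u x - c * inverse (w x) = (u x * w x - c) * inverse (w x)" using w0[of x] by (simp add: field_simps)
      then have "\<bar>u x - c * inverse (w x)\<bar> powr p = \<bar>u x * w x - c\<bar> powr p * inverse (w x) powr p"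
        using w0[of x] by (simp add: abs_mult powr_mult)
      then show ?thesis unfolding ew by (simp add: ennreal_mult[symmetric] \<sigma>_def mult_ac)
    qed
    have Y: "ennreal (norm (w x *\<^sub>R D x) powr p) * ennreal (exp_weight \<tau> \<gamma> (\<mu> * (p / \<gamma>)) x)
        = ennreal (norm (D x) powr p * norm x powr (- (p * b)))" for x
    proof -
      have "norm (w x *\<^sub>R D x) powr p * inverse (w x) powr p = norm (D x) powr p"
        using w0[of x] by (simp add: powr_mult[symmetric] field_simps)
      then show ?thesis unfolding ew by (simp add: ennreal_mult[symmetric] \<tau>_def mult_ac)
    qed
    have "integrable lborel (\<lambda>x. norm (D x) powr p * norm x powr (- (p * b)))"
      by (rule integrable_annulus_powr[OF _ r, where R = R])
         (use p suppD in \<open>auto intro!: continuous_intros cD continuous_on_powr'\<close>)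
    then have YT: "(\<integral>\<^sup>+x. ennreal (norm (D x) powr p * norm x powr (- (p * b))) \<partial>lborel) = ennreal T"
      unfolding T_def by (rule nn_integral_eq_integral) auto
    \<comment> \<open>The parameter for which the profile in the infimum coincides with v.\<close>
    define l where "l = \<mu> powr (- 1 / \<gamma>)"
    have l: "l > 0" using \<mu> by (simp add: l_def)
    have l\<gamma>: "l powr \<gamma> = 1 / \<mu>"
      using \<mu> \<gamma>0 unfolding l_def powr_powr by (simp add: powr_minus_divide)
    define W where "W c l = weighted_integral p (p * a) (\<lambda>x::real^'n. u x - c * exp (- (norm x powr (b - a + 1) / ((b - a + 1) * l powr (b - a + 1)))))" for c l
    have iw: "exp (- (norm x powr (b - a + 1) / ((b - a + 1) * l powr (b - a + 1)))) = inverse (w x)" for x :: "real ^ 'n"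
      unfolding \<gamma>_def[symmetric] l\<gamma> w_def using \<mu> \<gamma>0 by (simp add: exp_minus[symmetric] mult.commute)
    define Z where "Z = (\<integral>\<^sup>+x. ennreal (\<bar>u x - c * inverse (w x)\<bar> powr p * norm x powr (- (p * a))) \<partial>lborel)"
    have WZ: "W c l = enn2real Z"
      unfolding W_def iw weighted_integral_eq Z_def by (rule integral_eq_nn_integral) auto
    have "W c l \<le> K * \<mu> powr (-p) * T"
    \<comment> \<open>The case split discharges the finiteness premise of the Poincare inequality
      without an integrability proof.\<close>
    proof (cases "Z < \<infinity>")
      case True
      then have "Z \<le> ennreal (K * \<mu> powr (-p)) * ennreal T" using c unfolding X Y YT Z_def by simp
      also have "\<dots> = ennreal (K * \<mu> powr (-p) * T)" using K T0 by (simp add: ennreal_mult)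
      finally show ?thesis unfolding WZ using K T0 by (intro enn2real_leI) auto
    next
      case False
      \<comment> \<open>The Bochner integral of a function that is not integrable is 0.\<close>
      then have "W c l = 0" by (simp add: WZ less_top[symmetric])
      then show ?thesis using K T0 by simp
    qed
    moreover have "(INF (c, l) \<in> UNIV \<times> {0<..}. W c l) \<le> W c l"
    proof -
      have "(INF i \<in> UNIV \<times> {0<..}. case i of (c, l) \<Rightarrow> W c l) \<le> (case (c, l) of (c, l) \<Rightarrow> W c l)"
        using l by (intro cINF_lower bdd_belowI2[where m = 0]) (auto simp: W_def weighted_integral_nonneg)
      then show ?thesis by simp
    qed
    ultimately have INF: "(INF (c, l) \<in> UNIV \<times> {0<..}. W c l) \<le> K * \<mu> powr (-p) * T" by linarith
    have "C * \<mu> * (INF (c, l) \<in> UNIV \<times> {0<..}. W c l) \<le> C * \<mu> * (K * \<mu> powr (-p) * T)"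
      using C \<mu> INF by (intro mult_left_mono) auto
    also have "\<dots> = \<kappa> * T / (p * \<mu> powr (p - 1))"
      using K p \<mu> by (simp add: C_def powr_diff powr_minus field_simps)
    also have "\<dots> \<le> (p * \<mu> powr (p - 1) * (\<mu> * B - (CARD('n) - s) / p * S)) / (p * \<mu> powr (p - 1))"
    proof (rule divide_right_mono)
      have "\<mu> powr p = \<mu> powr (p - 1) * \<mu>" using \<mu> by (simp add: powr_diff)
      then have "A + (p - 1) * \<mu> powr p * B = p * (\<mu> powr (p - 1) * \<mu>) * B"
        unfolding \<mu>p[symmetric] by (simp add: algebra_simps)
      moreover have "p * \<mu> powr (p - 1) * (\<mu> * B - (CARD('n) - s) / p * S)
          = p * (\<mu> powr (p - 1) * \<mu>) * B - \<mu> powr (p - 1) * (CARD('n) - s) * S"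
        using p by (simp add: right_diff_distrib)
      ultimately show "\<kappa> * T \<le> p * \<mu> powr (p - 1) * (\<mu> * B - (CARD('n) - s) / p * S)"
        using deficit by linarith
    qed (use p in simp)
    also have "\<dots> = \<mu> * B - (CARD('n) - s) / p * S" using p \<mu> by simp
    finally show ?thesis
      unfolding stability_ineq_def A_def[symmetric] B_def[symmetric] AB \<mu>_def[symmetric] W_def S_def s_def
      by (simp add: diff_diff_eq)
  qed
  then show ?thesis using C by blast
qed

theorem theorem1p3:
  fixes N :: nat and p a b :: real
  assumes "N = CARD('n::finite)"
    and "real N > p" and "p \<ge> 2"
    and "0 \<le> b" and "b < (real N - p) / p"
    and "a = real N * b / (real N - p)"
  shows "(\<exists>C>0. \<forall>u :: real ^ 'n \<Rightarrow> real.
             u \<in> Cc_smooth_punctured - {\<lambda>x. 0} \<longrightarrow> stability_ineq p a b C u)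
       \<and> (\<forall>C>0. \<forall>u :: real ^ 'n \<Rightarrow> real.
             u \<in> Cc_smooth_punctured - {\<lambda>x. 0} \<longrightarrow>
               (stability_ineq p a b C u \<longleftrightarrow> normalized_stability_ineq p a b C u))"
proof -
  \<comment> \<open>After multiplication by N - p, both conditions required below, p a < N and b - a
    + 1 > 0, reduce to p b < N - p, the upper bound on b.\<close>
  have d: "real N - p > 0" and pb: "p * b < real N - p"
    using assms by (simp_all add: field_simps)
  have ad: "a * (real N - p) = real N * b" using assms d by simp
  have "0 \<le> a" using assms d by simp
  moreover have "p * a < CARD('n)"
  proof -
    have "p * a * (real N - p) = real N * (p * b)" using ad by (simp add: mult_ac)
    also have "\<dots> < real N * (real N - p)" using pb assms by (intro mult_strict_left_mono) auto
    finally show ?thesis using d assms(1) by simp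
  qed
  moreover have "0 < b - a + 1"
  proof -
    have "(b - a + 1) * (real N - p) = (real N - p) - p * b" using ad by (simp add: algebra_simps)
    then have "0 < (b - a + 1) * (real N - p)" using pb by simp
    then show ?thesis using d by (simp add: zero_less_mult_iff)
  qed
  ultimately show ?thesis
    using stability_ineq_exists[of p b a] stability_ineq_iff_normalized[of p b a] assms by auto
qed

end
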